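(* Suppose $n$ is an even integer with $t_2+t_3\leq n<t_1$, and put $K=k_1+k_2+k_3$, $N=\tfrac{n+1}{2}$. Then: (i) the $\mathfrak{BI}$-module $\mathscr M_n(x_2)\cap\mathscr M_n(x_3)$ is isomorphic to $W_1\oplus W_1$, where $W_1=O_{n-t_2-t_3}(k_1+k_3+N,\,-k_1-k_2-N,\,-N)^{((-1,1),(1\,3))}$; (ii) the $\mathfrak{BI}$-modules $\mathscr M_n(x_3)/(\mathscr M_n(x_2)\cap\mathscr M_n(x_3))$ and $\mathscr M_n/\mathscr M_n(x_2)$ are each isomorphic to $W_2\oplus W_2$, where $W_2=O_{t_2-1}(k_1,\,-K-n-1,\,-k_3)^{((1,-1),(1\,3))}$; (iii) the $\mathfrak{BI}$-modules $\mathscr M_n(x_2)/(\mathscr M_n(x_2)\cap\mathscr M_n(x_3))$ and $\mathscr M_n/\mathscr M_n(x_3)$ are each isomorphic to $W_3\oplus W_3$, where $W_3=O_{t_3-1}(k_1,\,-K-n-1,\,-k_2)^{((1,-1),(1\,3\,2))}$. Moreover, if $k_1\geq0$, then $W_1,W_2,W_3$ are irreducible and are isomorphic to $O_{n-t_2-t_3}(N,\,-k_1-k_2-N,\,-k_1-k_3-N)$, $O_{t_2-1}(k_3,\,K+n+1,\,k_1)$ and $O_{t_3-1}(k_2,\,k_1,\,K+n+1)$, respectively.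
   Context: Fix real numbers $k_1,k_2,k_3$. For $i=1,2,3$ let $R_i$ be the operator on functions on $\mathbb R^3$ replacing $x_i$ by $-x_i$, and $T_if=\frac{\partial f}{\partial x_i}+k_i\frac{f-R_if}{x_i}$ (Dunkl operators). Let $\sigma_1=\begin{pmatrix}0&1\\1&0\end{pmatrix}$, $\sigma_2=\begin{pmatrix}0&-\sqrt{-1}\\ \sqrt{-1}&0\end{pmatrix}$, $\sigma_3=\begin{pmatrix}1&0\\0&-1\end{pmatrix}$, and let $e_i$ act on $\mathbb C^2$ by $\sigma_i$. Tensor products are over $\mathbb R$; $\mathbb R[\cdots]_m$ denotes homogeneous polynomials of degree $m$. Let $\mathbf D=e_1\otimes T_1+e_2\otimes T_2+e_3\otimes T_3$ and $\mathscr M_n=\ker(\mathbf D|_{\mathbb C^2\otimes\mathbb R[x_1,x_2,x_3]_n})$. For $i=1,2,3$ set $t_i=-2k_i$ if $2k_i$ is an odd negative integer, and $t_i=\infty$ otherwise. For $i=1,2,3$, $\mathscr M_n(x_i)=\mathscr M_n\cap\bigoplus_{j=t_i}^n\mathbb C^2\otimes(x_i^j\cdot\mathbb R[x_p,x_q]_{n-j})$ where $\{p,q\}=\{1,2,3\}\setminus\{i\}$ (it is $\{0\}$ if $n<t_i$); it is a $\mathfrak{BI}$-submodule of $\mathscr M_n$. $\mathfrak{BI}$ is the unital associative $\mathbb C$-algebra generated by $X,Y,Z$ with relations saying that $\{X,Y\}-Z$, $\{Y,Z\}-X$, $\{Z,X\}-Y$ commute with $X,Y,Z$ ($\{A,B\}=AB+BA$).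 $\mathscr M_n$ is a $\mathfrak{BI}$-module via $X=(\sqrt{-1}\,e_1\otimes(x_3T_2-x_2T_3)+\tfrac12)R_2R_3+k_2R_3+k_3R_2$, $Y=(\sqrt{-1}\,e_2\otimes(x_1T_3-x_3T_1)+\tfrac12)R_1R_3+k_3R_1+k_1R_3$, $Z=(\sqrt{-1}\,e_3\otimes(x_2T_1-x_1T_2)+\tfrac12)R_1R_2+k_1R_2+k_2R_1$, operators composed right to left, $R_i$ acting on the polynomial factor. Twisting: for a $\mathfrak{BI}$-module $V$ and algebra automorphism $\varepsilon$, $V^\varepsilon$ is $V$ with action $x\cdot v=\varepsilon(x)v$. A permutation $\sigma\in\mathfrak S_3$ denotes the automorphism sending the generator with index $i$ in $(X,Y,Z)$ to the generator with index $\sigma(i)$; the sign automorphisms are $(1,-1)\colon X\mapsto X,Y\mapsto -Y,Z\mapsto -Z$; $(-1,1)\colon X\mapsto -X,Y\mapsto Y,Z\mapsto -Z$; $(-1,-1)\colon X\mapsto -X,Y\mapsto -Y,Z\mapsto Z$; a pair $(\epsilon,\sigma)$ denotes the composite $\epsilon\circ\sigma$. For $a,b,c\in\mathbb C$ and even $d\geq0$, $O_d(a,b,c)$ is the $\mathfrak{BI}$-module $\mathbb C^{d+1}$ in which, w.r.t. a basis $v_0,\dots,v_d$, $X$ acts by the lower bidiagonal matrix with diagonal $(\theta_0,\dots,\theta_d)$ and subdiagonal entries $1$, $Y$ by the upper bidiagonal matrix with diagonal $(\theta^*_0,\dots,\theta^*_d)$ and superdiagonal $(\varphi_1,\dots,\varphi_d)$,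 and $Z=\{X,Y\}-(2ab-c(d+1))$, where $\theta_i=\frac{(-1)^i(2a-d+2i)}{2}$, $\theta^*_i=\frac{(-1)^i(2b-d+2i)}{2}$, $\varphi_i=\frac{i(d+1-2i-2a-2b-2c)}{2}$ ($i$ even), $\varphi_i=\frac{(i-d-1)(d+1-2i-2a-2b+2c)}{2}$ ($i$ odd). *)

theory Defs
  imports Complex_Main "HOL-Library.Extended_Nat"
begin

type_synonym mono = "nat \<times> nat \<times> nat"   (* exponent vector (a,b,c) of x1^a x2^b x3^c *)
type_synonym cpoly = "mono \<Rightarrow> complex"
(* C^2 (x)_R R[x1,x2,x3]: component False = first basis vector of C^2, True = second *)
type_synonym spoly = "bool \<times> mono \<Rightarrow> complex"

definition expo :: "nat \<Rightarrow> mono \<Rightarrow> nat" where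
  "expo i m = (case m of (a,b,c) \<Rightarrow> if i = 1 then a else if i = 2 then b else c)"

definition incr :: "nat \<Rightarrow> mono \<Rightarrow> mono" where
  "incr i m = (case m of (a,b,c) \<Rightarrow>
     if i = 1 then (Suc a,b,c) else if i = 2 then (a,Suc b,c) else (a,b,Suc c))"

definition decr :: "nat \<Rightarrow> mono \<Rightarrow> mono" where
  "decr i m = (case m of (a,b,c) \<Rightarrow>
     if i = 1 then (a-1,b,c) else if i = 2 then (a,b-1,c) else (a,b,c-1))"

definition mdeg :: "mono \<Rightarrow> nat" where
  "mdeg m = (case m of (a,b,c) \<Rightarrow> a + b + c)"

definition reflP :: "nat \<Rightarrow> cpoly \<Rightarrow> cpoly" where
  "reflP i p = (\<lambda>m. (-1) ^ (expo i m) * p m)"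

definition mulxP :: "nat \<Rightarrow> cpoly \<Rightarrow> cpoly" where
  "mulxP i p = (\<lambda>m. if expo i m = 0 then 0 else p (decr i m))"

definition derivP :: "nat \<Rightarrow> cpoly \<Rightarrow> cpoly" where
  "derivP i p = (\<lambda>m. of_nat (Suc (expo i m)) * p (incr i m))"

text \<open>Division by x_i (exact on polynomials divisible by x_i, e.g. f - R_i f).\<close>
definition divxP :: "nat \<Rightarrow> cpoly \<Rightarrow> cpoly" where
  "divxP i p = (\<lambda>m. p (incr i m))"

definition dunkl :: "(nat \<Rightarrow> real) \<Rightarrow> nat \<Rightarrow> cpoly \<Rightarrow> cpoly" where
  "dunkl k i p = (\<lambda>m. derivP i p m
       + complex_of_real (k i) * divxP i (\<lambda>m'. p m' - reflP i p m') m)"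

definition liftP :: "(cpoly \<Rightarrow> cpoly) \<Rightarrow> spoly \<Rightarrow> spoly" where
  "liftP P v = (\<lambda>(s,m). P (\<lambda>m'. v (s,m')) m)"

definition pauli :: "nat \<Rightarrow> spoly \<Rightarrow> spoly" where
  "pauli i v = (\<lambda>(s,m).
     if i = 1 then v (\<not> s, m)
     else if i = 2 then (if s then \<i> * v (False, m) else - \<i> * v (True, m))
     else (if s then - v (True, m) else v (False, m)))"

definition diracD :: "(nat \<Rightarrow> real) \<Rightarrow> spoly \<Rightarrow> spoly" where
  "diracD k v = (\<lambda>x. pauli 1 (liftP (dunkl k 1) v) x + pauli 2 (liftP (dunkl k 2) v) x
                    + pauli 3 (liftP (dunkl k 3) v) x)"

definition homog :: "nat \<Rightarrow> spoly set" where
  "homog n = {v. \<forall>s m. v (s,m) \<noteq> 0 \<longrightarrow> mdeg m = n}"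

definition Mn :: "(nat \<Rightarrow> real) \<Rightarrow> nat \<Rightarrow> spoly set" where
  "Mn k n = {v \<in> homog n. diracD k v = (\<lambda>_. 0)}"

definition tpar :: "(nat \<Rightarrow> real) \<Rightarrow> nat \<Rightarrow> enat" where
  "tpar k i = (if \<exists>j::nat. odd j \<and> 2 * k i = - real j then enat (nat \<lfloor>- 2 * k i\<rfloor>) else \<infinity>)"

definition Mnx :: "(nat \<Rightarrow> real) \<Rightarrow> nat \<Rightarrow> nat \<Rightarrow> spoly set" where
  "Mnx k n i = {v \<in> Mn k n. \<forall>s m. v (s,m) \<noteq> 0 \<longrightarrow> tpar k i \<le> enat (expo i m)}"

record 'i bimod =
  car :: "('i \<Rightarrow> complex) set"
  opX :: "('i \<Rightarrow> complex) \<Rightarrow> ('i \<Rightarrow> complex)"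
  opY :: "('i \<Rightarrow> complex) \<Rightarrow> ('i \<Rightarrow> complex)"
  opZ :: "('i \<Rightarrow> complex) \<Rightarrow> ('i \<Rightarrow> complex)"

definition genOp :: "(nat \<Rightarrow> real) \<Rightarrow> nat \<Rightarrow> nat \<Rightarrow> nat \<Rightarrow> spoly \<Rightarrow> spoly" where
  "genOp k i p q v =
     (let w = liftP (reflP p \<circ> reflP q) v;
          A = liftP (\<lambda>f m. mulxP q (dunkl k p f) m - mulxP p (dunkl k q f) m) w
      in (\<lambda>x. \<i> * pauli i A x + 1/2 * w x
             + complex_of_real (k p) * liftP (reflP q) v x
             + complex_of_real (k q) * liftP (reflP p) v x))"

definition Mmod :: "(nat \<Rightarrow> real) \<Rightarrow> spoly set \<Rightarrow> (bool \<times> mono) bimod" where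
  "Mmod k S = \<lparr>car = S, opX = genOp k 1 2 3, opY = genOp k 2 3 1, opZ = genOp k 3 1 2\<rparr>"

definition Otheta :: "complex \<Rightarrow> nat \<Rightarrow> nat \<Rightarrow> complex" where
  "Otheta a d i = (-1) ^ i * (2 * a - of_nat d + 2 * of_nat i) / 2"

definition Ophi :: "complex \<Rightarrow> complex \<Rightarrow> complex \<Rightarrow> nat \<Rightarrow> nat \<Rightarrow> complex" where
  "Ophi a b c d i = (if even i
      then of_nat i * (of_nat d + 1 - 2 * of_nat i - 2 * a - 2 * b - 2 * c) / 2
      else (of_nat i - of_nat d - 1) * (of_nat d + 1 - 2 * of_nat i - 2 * a - 2 * b + 2 * c) / 2)"

definition OX :: "complex \<Rightarrow> nat \<Rightarrow> (nat \<Rightarrow> complex) \<Rightarrow> (nat \<Rightarrow> complex)" where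
  "OX a d v = (\<lambda>i. if i \<le> d then Otheta a d i * v i + (if i = 0 then 0 else v (i - 1)) else 0)"

definition OY :: "complex \<Rightarrow> complex \<Rightarrow> complex \<Rightarrow> nat \<Rightarrow> (nat \<Rightarrow> complex) \<Rightarrow> (nat \<Rightarrow> complex)" where
  "OY a b c d v = (\<lambda>i. if i \<le> d then Otheta b d i * v i
                         + (if i < d then Ophi a b c d (Suc i) * v (Suc i) else 0) else 0)"

definition Omod :: "complex \<Rightarrow> complex \<Rightarrow> complex \<Rightarrow> nat \<Rightarrow> nat bimod" where
  "Omod a b c d = \<lparr>car = {v. \<forall>i>d. v i = 0}, opX = OX a d, opY = OY a b c d,
     opZ = (\<lambda>v i. OX a d (OY a b c d v) i + OY a b c d (OX a d v) i
                  - (2 * a * b - c * (of_nat d + 1)) * v i)\<rparr>"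

definition genOf :: "'i bimod \<Rightarrow> nat \<Rightarrow> ('i \<Rightarrow> complex) \<Rightarrow> ('i \<Rightarrow> complex)" where
  "genOf M j = (if j = 1 then opX M else if j = 2 then opY M else opZ M)"

text \<open>Twist by the automorphism (eps, sigma) = eps o sigma; eps = (s1,s2) multiplies
  X by s1, Y by s2, Z by s1*s2; sigma sends the generator of index j to index sigma j.\<close>
definition twist :: "int \<times> int \<Rightarrow> (nat \<Rightarrow> nat) \<Rightarrow> 'i bimod \<Rightarrow> 'i bimod" where
  "twist eps \<sigma> M =
     (let sg = (\<lambda>j. if j = 1 then fst eps else if j = 2 then snd eps else fst eps * snd eps)
      in M\<lparr>opX := (\<lambda>v x. of_int (sg (\<sigma> 1)) * genOf M (\<sigma> 1) v x),
           opY := (\<lambda>v x. of_int (sg (\<sigma> 2)) * genOf M (\<sigma> 2) v x),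
           opZ := (\<lambda>v x. of_int (sg (\<sigma> 3)) * genOf M (\<sigma> 3) v x)\<rparr>)"

definition perm13 :: "nat \<Rightarrow> nat" where
  "perm13 j = (if j = 1 then 3 else if j = 3 then 1 else j)"

definition perm132 :: "nat \<Rightarrow> nat" where
  "perm132 j = (if j = 1 then 3 else if j = 3 then 2 else if j = 2 then 1 else j)"

definition dsum2 :: "'i bimod \<Rightarrow> (bool \<times> 'i) bimod" where
  "dsum2 M = \<lparr>car = {v. \<forall>s. (\<lambda>i. v (s,i)) \<in> car M},
     opX = (\<lambda>v (s,i). opX M (\<lambda>j. v (s,j)) i),
     opY = (\<lambda>v (s,i). opY M (\<lambda>j. v (s,j)) i),
     opZ = (\<lambda>v (s,i). opZ M (\<lambda>j. v (s,j)) i)\<rparr>"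

definition lin_on :: "('i \<Rightarrow> complex) set \<Rightarrow> (('i \<Rightarrow> complex) \<Rightarrow> ('j \<Rightarrow> complex)) \<Rightarrow> bool" where
  "lin_on V f = (\<forall>u\<in>V. \<forall>w\<in>V. \<forall>c::complex.
      f (\<lambda>x. u x + w x) = (\<lambda>y. f u y + f w y) \<and> f (\<lambda>x. c * u x) = (\<lambda>y. c * f u y))"

definition bim_hom :: "'i bimod \<Rightarrow> 'j bimod \<Rightarrow> (('i \<Rightarrow> complex) \<Rightarrow> ('j \<Rightarrow> complex)) \<Rightarrow> bool" where
  "bim_hom M N f = ((\<forall>v\<in>car M. f v \<in> car N) \<and> lin_on (car M) f \<and>
     (\<forall>v\<in>car M. f (opX M v) = opX N (f v) \<and> f (opY M v) = opY N (f v)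
                 \<and> f (opZ M v) = opZ N (f v)))"

definition bim_iso :: "'i bimod \<Rightarrow> 'j bimod \<Rightarrow> bool" where
  "bim_iso M N = (\<exists>f. bim_hom M N f \<and> bij_betw f (car M) (car N))"

text \<open>M/S is isomorphic to N (S a submodule of M): there is a surjective module
  homomorphism M -> N with kernel exactly S.\<close>
definition bim_quot_iso :: "'i bimod \<Rightarrow> ('i \<Rightarrow> complex) set \<Rightarrow> 'j bimod \<Rightarrow> bool" where
  "bim_quot_iso M S N = (\<exists>f. bim_hom M N f \<and> f ` car M = car N \<and> {v \<in> car M. f v = (\<lambda>_. 0)} = S)"

definition bim_irred :: "'i bimod \<Rightarrow> bool" where
  "bim_irred M = (car M \<noteq> {\<lambda>_. 0} \<and>
     (\<forall>S. S \<subseteq> car M \<and> (\<lambda>_. 0) \<in> S \<and> (\<forall>u\<in>S. \<forall>w\<in>S. (\<lambda>x. u x + w x) \<in> S)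
        \<and> (\<forall>u\<in>S. \<forall>c::complex. (\<lambda>x. c * u x) \<in> S)
        \<and> (\<forall>u\<in>S. opX M u \<in> S \<and> opY M u \<in> S \<and> opZ M u \<in> S)
        \<longrightarrow> S = {\<lambda>_. 0} \<or> S = car M))"

end

theory Submission
  imports Defs "HOL-Library.Function_Algebras"
begin

text \<open>
Since n is smaller than t1, an element of Mn is determined by its restriction to the plane x1 = 0,
and that restriction is arbitrary (Cauchy--Kovalevskaya extension). On the restriction, the operators
X, Y, Z involve the matrix part only through e1, so Mn splits into two submodules according to the
eigenvalues 1 and -1 of e1. In the basis of the monomials in x2, x3 of degree n, Y is upper and Z is
lower bidiagonal with explicit entries, and the entries that vanish at the exponents t2 and t3 cut out
the submodules; up to rescaling the basis, the windows between them are the modules O with a sign twist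
and a permutation of X, Y, Z.

For irreducibility of O, take an element of a submodule with smallest top index. It is an eigenvector
of Y, and an operator that lowers its top index by one produces a coefficient that factors completely.
For the last isomorphisms, O with parameters (a, b, c) maps to any module in which the three
anticommutator relations hold with the right constants, provided that it has a suitable eigenvector
of Y. A nonzero map onto an irreducible module of the same dimension is bijective.
\<close>

section \<open>The modules O\<close>

text \<open>The sign twists come from the place where a window starts: on a window beginning at j0,
  the sign (-1)^j leaves a factor (-1)^j0 in front of Y and Z, which is 1 for the window at 0 and -1
  for the window at the odd exponent t2. W3 needs no second calculation: exchanging x2 and x3
  reverses the monomials, swaps Y with Z and negates the eigenvalue of e1.

  The last isomorphisms cannot rest on eigenbases: if 2 k1 is an odd integer, the diagonal entries
  theta_i for a = k1 may repeat, and the operator need not be diagonalizable. A single eigenvector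
  v_0 is enough instead. Put v_{i+1} = (X - theta_i) v_i; eliminating Z from the relations gives a
  cubic identity that determines Y v_{i+2} from Y v_i and Y v_{i+1}. Only Y v_1 has to be found
  separately, and there the three cases differ.\<close>

lemma Otheta_alt: "Otheta a d i = (-1) ^ i * (a - of_nat d / 2 + of_nat i)"
  by (simp add: Otheta_def field_simps)

lemma Ophi_0 [simp]: "Ophi a b c d 0 = 0"
  by (simp add: Ophi_def)

lemma Ophi_top [simp]: "even d \<Longrightarrow> Ophi a b c d (Suc d) = 0"
  by (simp add: Ophi_def)

text \<open>Splitting by parity removes the powers of -1, so that the relations below become
  polynomial identities, which \<open>algebra\<close> decides. The \<open>Suc\<close> patterns are
  those of neighbouring rows.\<close>

lemma Otheta_even_odd:
  "Otheta a (2 * m) 0 = a - of_nat m"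
  "Otheta a (2 * m) (2 * l) = a - of_nat m + 2 * of_nat l"
  "Otheta a (2 * m) (Suc (2 * l)) = - (a - of_nat m + 2 * of_nat l + 1)"
  "Otheta a (2 * m) (Suc (Suc (2 * l))) = a - of_nat m + 2 * of_nat l + 2"
  "Otheta a (2 * m) (Suc (Suc (Suc (2 * l)))) = - (a - of_nat m + 2 * of_nat l + 3)"
  "Otheta a (2 * m) (Suc (Suc (Suc (Suc (2 * l))))) = a - of_nat m + 2 * of_nat l + 4"
  by (simp_all add: Otheta_alt)

lemma Ophi_even_odd:
  "Ophi a b c (2 * m) (2 * l) = of_nat l * (2 * of_nat m + 1 - 4 * of_nat l - 2 * a - 2 * b - 2 * c)"
  "Ophi a b c (2 * m) (Suc (2 * l)) = (of_nat l - of_nat m) * (2 * of_nat m - 1 - 4 * of_nat l - 2 * a - 2 * b + 2 * c)"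
  "Ophi a b c (2 * m) (Suc (Suc (2 * l))) = (of_nat l + 1) * (2 * of_nat m - 3 - 4 * of_nat l - 2 * a - 2 * b - 2 * c)"
  "Ophi a b c (2 * m) (Suc (Suc (Suc (2 * l)))) = (of_nat l + 1 - of_nat m) * (2 * of_nat m - 5 - 4 * of_nat l - 2 * a - 2 * b + 2 * c)"
  "Ophi a b c (2 * m) (Suc (Suc (Suc (Suc (2 * l))))) = (of_nat l + 2) * (2 * of_nat m - 7 - 4 * of_nat l - 2 * a - 2 * b - 2 * c)"
  "Ophi a b c (2 * m) (Suc (Suc (Suc (Suc (Suc (2 * l)))))) = (of_nat l + 2 - of_nat m) * (2 * of_nat m - 9 - 4 * of_nat l - 2 * a - 2 * b + 2 * c)"
  by (simp_all add: Ophi_def field_simps)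

section \<open>Closed form of Z on O and the three anticommutator relations\<close>

definition OZdiag :: "complex \<Rightarrow> nat \<Rightarrow> nat \<Rightarrow> complex" where
  "OZdiag c d i = (-1) ^ i * (c + (of_nat d + 1) / 2) - 1 / 2"

text \<open>The anticommutator of X and Y is tridiagonal. Since theta_i + theta_{i-1} = (-1)^i, and
  likewise for theta*, its off-diagonal entries reduce to signs below the diagonal and to phi_{i+1}
  up to sign above it.\<close>

definition OZ :: "complex \<Rightarrow> complex \<Rightarrow> complex \<Rightarrow> nat \<Rightarrow> (nat \<Rightarrow> complex) \<Rightarrow> nat \<Rightarrow> complex" where
  "OZ a b c d v = (\<lambda>i. if i \<le> d
     then OZdiag c d i * v i
       + (if i = 0 then 0 else (-1) ^ i * v (i - 1))
       - (if i < d then (-1) ^ i * Ophi a b c d (Suc i) * v (Suc i) else 0)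
     else 0)"

definition Ospace :: "nat \<Rightarrow> (nat \<Rightarrow> complex) set" where
  "Ospace d = {v. \<forall>i>d. v i = 0}"

lemma OspaceD: "v \<in> Ospace d \<Longrightarrow> d < i \<Longrightarrow> v i = 0"
  by (simp add: Ospace_def)

lemma O_closed [simp]: "OX a d v \<in> Ospace d" "OY a b c d v \<in> Ospace d" "OZ a b c d v \<in> Ospace d"
  by (auto simp: Ospace_def OX_def OY_def OZ_def)

lemma OZdiag_even_odd:
  "OZdiag c (2 * m) 0 = c + of_nat m"
  "OZdiag c (2 * m) (2 * l) = c + of_nat m"
  "OZdiag c (2 * m) (Suc (2 * l)) = - (c + of_nat m + 1)"
  "OZdiag c (2 * m) (Suc (Suc (2 * l))) = c + of_nat m"
  "OZdiag c (2 * m) (Suc (Suc (Suc (2 * l)))) = - (c + of_nat m + 1)"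
  "OZdiag c (2 * m) (Suc (Suc (Suc (Suc (2 * l))))) = c + of_nat m"
  by (simp_all add: OZdiag_def field_simps)

lemma OX_apply:
  assumes "even d" "v \<in> Ospace d"
  shows "OX a d v 0 = Otheta a d 0 * v 0"
    "Suc i \<le> d \<Longrightarrow> OX a d v (Suc i) = Otheta a d (Suc i) * v (Suc i) + v i"
    "i \<le> d \<Longrightarrow> Ophi a' b c d (Suc i) * OX a d v (Suc i) = Ophi a' b c d (Suc i) * (Otheta a d (Suc i) * v (Suc i) + v i)"
  using assms by (cases "i = d"; simp add: OX_def)+

text \<open>The version multiplied by phi_{i+1} also holds in the last row i = d, because phi_{d+1}
  = 0 for even d. The upper end of the index range thus needs no case of its own in the
  relations.\<close>

lemma OY_apply:
  assumes "even d" "v \<in> Ospace d"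
  shows "i \<le> d \<Longrightarrow> OY a b c d v i = Otheta b d i * v i + Ophi a b c d (Suc i) * v (Suc i)"
    "i \<le> d \<Longrightarrow> Ophi a b c d (Suc i) * OY a b c d v (Suc i)
       = Ophi a b c d (Suc i) * (Otheta b d (Suc i) * v (Suc i) + Ophi a b c d (Suc (Suc i)) * v (Suc (Suc i)))"
  using assms OspaceD[OF assms(2)]
  by (cases "i = d"; cases "Suc i = d"; auto simp: OY_def)+

lemma OZ_apply:
  assumes "even d" "v \<in> Ospace d"
  shows "OZ a b c d v 0 = OZdiag c d 0 * v 0 - Ophi a b c d 1 * v 1"
    "Suc i \<le> d \<Longrightarrow> OZ a b c d v (Suc i) = OZdiag c d (Suc i) * v (Suc i)
       + (if even i then -1 else 1) * (v i - Ophi a b c d (Suc (Suc i)) * v (Suc (Suc i)))"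
    "i \<le> d \<Longrightarrow> Ophi a b c d (Suc i) * OZ a b c d v (Suc i) = Ophi a b c d (Suc i) *
       (OZdiag c d (Suc i) * v (Suc i)
        + (if even i then -1 else 1) * (v i - Ophi a b c d (Suc (Suc i)) * v (Suc (Suc i))))"
  using assms OspaceD[OF assms(2)]
  by (cases "i = d"; cases "Suc i = d"; auto simp: OZ_def algebra_simps)+

text \<open>Rows 0 and 1 are separate because a product of two of the operators can reach back to
  index i - 2.\<close>

lemma parity_induct [case_names zero one even odd]:
  assumes "P 0" "P 1" "\<And>l. P (Suc (Suc (2 * l)))" "\<And>l. P (Suc (Suc (Suc (2 * l))))"
  shows "P i"
proof -
  have "i = 0 \<or> i = 1 \<or> (\<exists>l. i = Suc (Suc (2 * l))) \<or> (\<exists>l. i = Suc (Suc (Suc (2 * l))))"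
    by presburger
  then show ?thesis using assms by blast
qed

lemmas parity_rules = Otheta_even_odd Ophi_even_odd OZdiag_even_odd
  Otheta_even_odd(3,4,5)[where l = 0, simplified] Ophi_even_odd(2,3,4,5)[where l = 0, simplified]
  OZdiag_even_odd(3,4,5)[where l = 0, simplified]

text \<open>This and the next two relations are cyclic in (X, Y, Z) and (a, b, c) simultaneously.
  Hence a twist that permutes and negates the generators can satisfy the same relations with
  permuted and negated parameters, which predicts the target of each isomorphism below.\<close>

lemma O_rel_XY:
  assumes "v \<in> Ospace (2 * m)" "i \<le> 2 * m"
  shows "OX a (2 * m) (OY a b c (2 * m) v) i + OY a b c (2 * m) (OX a (2 * m) v) i = OZ a b c (2 * m) v i + (2 * a * b - c * (2 * of_nat m + 1)) * v i"
  using assms(2)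
  by (induct i rule: parity_induct; simp add: OX_apply OY_apply OZ_apply assms(1); simp only: parity_rules; algebra)

lemma O_rel_YZ:
  assumes "v \<in> Ospace (2 * m)" "i \<le> 2 * m"
  shows "OY a b c (2 * m) (OZ a b c (2 * m) v) i + OZ a b c (2 * m) (OY a b c (2 * m) v) i = OX a (2 * m) v i + (2 * b * c - a * (2 * of_nat m + 1)) * v i"
  using assms(2)
  by (induct i rule: parity_induct; simp add: OX_apply OY_apply OZ_apply assms(1); simp only: parity_rules; algebra)

lemma O_rel_ZX:
  assumes "v \<in> Ospace (2 * m)" "i \<le> 2 * m"
  shows "OZ a b c (2 * m) (OX a (2 * m) v) i + OX a (2 * m) (OZ a b c (2 * m) v) i = OY a b c (2 * m) v i + (2 * c * a - b * (2 * of_nat m + 1)) * v i"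
  using assms(2)
  by (induct i rule: parity_induct; simp add: OX_apply OY_apply OZ_apply assms(1); simp only: parity_rules; algebra)

lemma opZ_Omod:
  assumes "v \<in> Ospace (2 * m)"
  shows "opZ (Omod a b c (2 * m)) v = OZ a b c (2 * m) v"
proof
  fix i
  show "opZ (Omod a b c (2 * m)) v i = OZ a b c (2 * m) v i"
  proof (cases "i \<le> 2 * m")
    case True then show ?thesis using O_rel_XY[OF assms True, of a b c] by (simp add: Omod_def)
  next
    case False then show ?thesis using OspaceD[OF assms] by (simp add: Omod_def OX_def OY_def OZ_def)
  qed
qed

section \<open>Split bases\<close>

lemma lin_comb2:
  "lin_on UNIV F \<Longrightarrow> F (\<lambda>x. p * f x + q * g x) = (\<lambda>x. p * F f x + q * F g x)"
proof -
  assume l: "lin_on UNIV F"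
  have 1: "\<And>u w. F (\<lambda>x. u x + w x) = (\<lambda>y. F u y + F w y)" "\<And>u c. F (\<lambda>x. c * u x) = (\<lambda>y. c * F u y)"
    using l unfolding lin_on_def by auto
  show ?thesis using 1(1)[of "\<lambda>x. p * f x" "\<lambda>x. q * g x"] by (simp add: 1(2))
qed

lemma lin_comb3:
  "lin_on UNIV F \<Longrightarrow> F (\<lambda>x. p * f x + q * g x + r * h x) = (\<lambda>x. p * F f x + q * F g x + r * F h x)"
  using lin_comb2[of F 1 "\<lambda>x. p * f x + q * g x" r h] by (simp add: lin_comb2)

lemma lin_sum:
  assumes "lin_on UNIV F"
  shows "F (\<lambda>x. \<Sum>i\<le>(d::nat). u i * V i x) = (\<lambda>x. \<Sum>i\<le>d. u i * F (V i) x)"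
proof (induction d)
  case 0 show ?case using lin_comb2[OF assms, of "u 0" "V 0" 0 "V 0"] by simp
next
  case (Suc d)
  show ?case using lin_comb2[OF assms, of 1 "\<lambda>x. \<Sum>i\<le>d. u i * V i x" "u (Suc d)" "V (Suc d)"]
    by (simp add: Suc)
qed

lemma lin_zero: "lin_on UNIV F \<Longrightarrow> F (\<lambda>x. 0) = (\<lambda>x. 0)"
  using lin_comb2[of F 0 "\<lambda>x. 0" 0 "\<lambda>x. 0"] by simp

lemma lin_on_OX: "lin_on UNIV (OX a d)"
  by (auto simp: lin_on_def OX_def algebra_simps fun_eq_iff)

lemma lin_on_OY: "lin_on UNIV (OY a b c d)"
  by (auto simp: lin_on_def OY_def algebra_simps fun_eq_iff)

text \<open>If X is to be lower bidiagonal with diagonal theta_i and subdiagonal 1, the first basis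
  vector forces all the others in this way.\<close>

primrec split_vec :: "((nat \<Rightarrow> complex) \<Rightarrow> (nat \<Rightarrow> complex)) \<Rightarrow> complex \<Rightarrow> nat \<Rightarrow> (nat \<Rightarrow> complex) \<Rightarrow> nat \<Rightarrow> nat \<Rightarrow> complex" where
  "split_vec X a d v0 0 = v0"
| "split_vec X a d v0 (Suc i) = (\<lambda>x. X (split_vec X a d v0 i) x - Otheta a d i * split_vec X a d v0 i x)"

text \<open>The assumption \<open>cubic\<close> is the relation for {Z, X} with Z eliminated.
  Applied to v_i, its term Y X X v_i contributes Y v_{i+2} with coefficient 1, and everything else
  is known from Y v_i and Y v_{i+1}. Hence the induction carries two consecutive vectors and needs
  \<open>v1\<close> to start.\<close>

lemma Y_split_vec:
  fixes m :: nat
  assumes lX: "lin_on UNIV X" and lY: "lin_on UNIV Y"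
    and cX: "\<And>v. v \<in> Ospace D \<Longrightarrow> X v \<in> Ospace D"
    and cubic: "\<And>v x. v \<in> Ospace D \<Longrightarrow> X (X (Y v)) x + 2 * X (Y (X v)) x + Y (X (X v)) x
        - 2 * (2 * a * b - c * (2 * of_nat m + 1)) * X v x = Y v x + (2 * c * a - b * (2 * of_nat m + 1)) * v x"
    and v0: "v0 \<in> Ospace D" "Y v0 = (\<lambda>x. Otheta b (2 * m) 0 * v0 x)"
    and v1: "Y (split_vec X a (2 * m) v0 1) = (\<lambda>x. Otheta b (2 * m) 1 * split_vec X a (2 * m) v0 1 x + Ophi a b c (2 * m) 1 * v0 x)"
  shows "split_vec X a (2 * m) v0 i \<in> Ospace D"
    "Y (split_vec X a (2 * m) v0 i) = (\<lambda>x. Otheta b (2 * m) i * split_vec X a (2 * m) v0 i x + Ophi a b c (2 * m) i * split_vec X a (2 * m) v0 (i - 1) x)"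
proof -
  let ?v = "split_vec X a (2 * m) v0" and ?t = "Otheta a (2 * m)" and ?s = "Otheta b (2 * m)" and ?p = "Ophi a b c (2 * m)"
  show mem: "?v i \<in> Ospace D" for i
    using v0(1) by (induction i) (use cX in \<open>auto simp: Ospace_def\<close>)
  have Xv: "X (?v i) = (\<lambda>x. 1 * ?v (Suc i) x + ?t i * ?v i x)" for i by simp
  \<comment> \<open>Treating phi_i v_{i-1} as one vector makes i = 0 regular, since phi_0 = 0. The
    coefficient of \<open>w i\<close> in \<open>Xw\<close> is theta_{i-1}, written so that it makes
    sense for i = 0 too.\<close>
  define w where "w i = (\<lambda>x. ?p i * ?v (i - 1) x)" for i
  have Xw: "X (w i) = (\<lambda>x. ?p i * ?v i x + (if even i then - (a - of_nat m + of_nat i - 1) else a - of_nat m + of_nat i - 1) * w i x)" for i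
  proof (cases i)
    case 0 then show ?thesis by (simp add: w_def lin_zero[OF lX])
  next
    case (Suc j)
    have "X (w i) = (\<lambda>x. ?p i * X (?v j) x)"
      using lin_comb2[OF lX, of "?p i" "?v j" 0 "?v j"] unfolding w_def Suc by simp
    then show ?thesis unfolding Xv Suc w_def by (auto simp: algebra_simps Otheta_alt)
  qed
  have "Y (?v i) = (\<lambda>x. ?s i * ?v i x + 1 * w i x) \<and> Y (?v (Suc i)) = (\<lambda>x. ?s (Suc i) * ?v (Suc i) x + ?p (Suc i) * ?v i x)" for i
  proof (induction i)
    case 0 then show ?case using v0(2) v1 by (simp add: w_def)
  next
    case (Suc i)
    define u u1 u2 W where "u = ?v i" and "u1 = ?v (Suc i)" and "u2 = ?v (Suc (Suc i))" and "W = w i"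
    define z where "z = (if even i then - (a - of_nat m + of_nat i - 1) else a - of_nat m + of_nat i - 1)"
    have Xu: "X u = (\<lambda>x. 1 * u1 x + ?t i * u x)" "X u1 = (\<lambda>x. 1 * u2 x + ?t (Suc i) * u1 x)"
      unfolding u_def u1_def u2_def Xv by simp_all
    have Yu: "Y u = (\<lambda>x. ?s i * u x + 1 * W x)" "Y u1 = (\<lambda>x. ?s (Suc i) * u1 x + ?p (Suc i) * u x)"
      using Suc unfolding u_def u1_def W_def by simp_all
    have XW: "X W = (\<lambda>x. ?p i * u x + z * W x)"
      unfolding W_def Xw u_def z_def ..
    have uD: "u \<in> Ospace D" unfolding u_def by (rule mem)
    have Y2: "Y u2 x = ?s (Suc (Suc i)) * u2 x + ?p (Suc (Suc i)) * u1 x" for x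
    proof -
      have par: "even i \<and> (\<exists>l. i = 2 * l) \<or> odd i \<and> (\<exists>l. i = Suc (2 * l))" by presburger
      have XY: "X (Y u) = (\<lambda>x. ?s i * u1 x + (?s i * ?t i + ?p i) * u x + z * W x)"
        unfolding Yu lin_comb2[OF lX] Xu XW by (simp add: algebra_simps)
      have YX: "Y (X u) = (\<lambda>x. (?s (Suc i)) * u1 x + (?p (Suc i) + ?t i * ?s i) * u x + ?t i * W x)"
        unfolding Xu lin_comb2[OF lY] Yu by (simp add: algebra_simps)
      have XX: "X (X u) = (\<lambda>x. 1 * u2 x + (?t (Suc i) + ?t i) * u1 x + (?t i)\<^sup>2 * u x)"
        unfolding Xu(1) lin_comb2[OF lX] Xu by (simp add: algebra_simps power2_eq_square)
      have eq: "X (X (Y u)) x + 2 * X (Y (X u)) x + Y (X (X u)) x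
        - 2 * (2 * a * b - c * (2 * of_nat m + 1)) * X u x = Y u x + (2 * c * a - b * (2 * of_nat m + 1)) * u x"
        using cubic[OF uD] .
      have XXY: "X (X (Y u)) x = ?s i * (u2 x + ?t (Suc i) * u1 x) + (?s i * ?t i + ?p i) * (u1 x + ?t i * u x) + z * (?p i * u x + z * W x)"
        unfolding XY lin_comb3[OF lX] unfolding Xu XW by simp
      have XYX: "X (Y (X u)) x = ?s (Suc i) * (u2 x + ?t (Suc i) * u1 x) + (?p (Suc i) + ?t i * ?s i) * (u1 x + ?t i * u x) + ?t i * (?p i * u x + z * W x)"
        unfolding YX lin_comb3[OF lX] unfolding Xu XW by simp
      have YXX: "Y (X (X u)) x = Y u2 x + (?t (Suc i) + ?t i) * (?s (Suc i) * u1 x + ?p (Suc i) * u x) + (?t i)\<^sup>2 * (?s i * u x + W x)"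
        unfolding XX lin_comb3[OF lY] unfolding Yu by simp
      have Xux: "X u x = u1 x + ?t i * u x" and Yux: "Y u x = ?s i * u x + W x" unfolding Xu Yu by simp_all
      note eq' = eq[unfolded XXY XYX YXX Xux Yux z_def]
      from par show ?thesis
      proof (elim disjE conjE exE)
        fix l assume l: "i = 2 * l"
        show ?thesis using eq' unfolding l by (simp add: parity_rules) algebra
      next
        fix l assume l: "i = Suc (2 * l)"
        show ?thesis using eq' unfolding l by (simp add: parity_rules) algebra
      qed
    qed
    then show ?case using Suc unfolding u2_def u1_def w_def by auto
  qed
  then show "Y (?v i) = (\<lambda>x. ?s i * ?v i x + ?p i * ?v (i - 1) x)"
    by (simp add: w_def)
qed

section \<open>Irreducibility\<close>

lemma sum_fun_apply: "(\<Sum>i\<in>A. F i) = (\<lambda>x. \<Sum>i\<in>A. F i x :: complex)"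
  by (induction A rule: infinite_finite_induct) (auto simp: fun_eq_iff)

text \<open>A kernel vector with a nonzero entry at p expresses the image of the p-th unit vector
  through the images of the d others. Then at most d vectors would span a space containing d + 1
  independent ones.\<close>

lemma linear_surj_inj:
  assumes lin: "lin_on UNIV f" and onto: "f ` Ospace d = Ospace d"
    and u: "u \<in> Ospace d" "f u = (\<lambda>_. 0)"
  shows "u = (\<lambda>_. 0)"
proof -
  interpret vs: vector_space "\<lambda>c (v :: nat \<Rightarrow> complex) x. c * v x"
    by unfold_locales (auto simp: algebra_simps fun_eq_iff)
  define e where "e = (\<lambda>i j :: nat. if i = j then 1 else 0 :: complex)"
  have expand: "v = (\<lambda>x. \<Sum>i\<le>d. v i * e i x)" if "v \<in> Ospace d" for v
    using OspaceD[OF that] by (auto simp: e_def fun_eq_iff if_distrib[of "\<lambda>t. _ * t"] cong: if_cong)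
  have e_in: "e i \<in> Ospace d" if "i \<le> d" for i using that by (auto simp: e_def Ospace_def)
  have fexp: "f v = (\<lambda>x. \<Sum>i\<le>d. v i * f (e i) x)" if "v \<in> Ospace d" for v
    by (subst expand[OF that]) (rule lin_sum[OF lin])
  have inje: "inj_on e {..d}" by (auto simp: inj_on_def e_def fun_eq_iff split: if_splits)
  have indep: "vs.independent (e ` {..d})"
    unfolding vs.independent_explicit_module
  proof (intro allI impI)
    fix t c v assume t: "finite t" "t \<subseteq> e ` {..d}" "(\<Sum>w\<in>t. (\<lambda>x. c w * w x)) = 0" "v \<in> t"
    then obtain i where i: "v = e i" "i \<le> d" by auto
    have "0 = (\<Sum>w\<in>t. c w * w i)" using fun_cong[OF t(3), of i] by (simp add: sum_fun_apply)
    also have "\<dots> = (\<Sum>w\<in>t. if w = v then c v else 0)"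
      using t(2) i by (intro sum.cong) (auto simp: e_def split: if_splits)
    finally show "c v = 0" using t by simp
  qed
  show ?thesis
  proof (rule ccontr)
    assume "u \<noteq> (\<lambda>_. 0)"
    then obtain p where p: "u p \<noteq> 0" by (auto simp: fun_eq_iff)
    then have pd: "p \<le> d" using OspaceD[OF u(1), of p] by (metis not_le)
    let ?T = "(\<lambda>i. f (e i)) ` ({..d} - {p})"
    have T: "f (e i) \<in> vs.span ?T" if "i \<le> d" for i
    proof (cases "i = p")
      case False then show ?thesis using that by (intro vs.span_base) auto
    next
      case True
      have "(\<Sum>i\<in>{..d} - {p}. u i * f (e i) x) + u p * f (e p) x = 0" for x
        using fun_cong[OF fexp[OF u(1)], of x] u(2) pd by (simp add: sum.remove[of "{..d}" p] add.commute)
      then have "f (e p) = (\<Sum>i\<in>{..d} - {p}. (\<lambda>x. (- u i / u p) * f (e i) x))"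
        using p unfolding sum_fun_apply by (auto simp: fun_eq_iff field_simps eq_neg_iff_add_eq_0 sum_negf sum_distrib_left simp flip: sum_divide_distrib)
      also have "\<dots> \<in> vs.span ?T" by (intro vs.span_sum vs.span_scale vs.span_base) auto
      finally show ?thesis using True by simp
    qed
    have "e ` {..d} \<subseteq> vs.span ?T"
    proof
      fix v assume "v \<in> e ` {..d}"
      then have "v \<in> f ` Ospace d" using onto e_in by auto
      then obtain w where w: "w \<in> Ospace d" "v = f w" by blast
      have "f w = (\<Sum>i\<in>{..d}. (\<lambda>x. w i * f (e i) x))" by (subst fexp[OF w(1)]) (simp add: sum_fun_apply)
      also have "\<dots> \<in> vs.span ?T" by (intro vs.span_sum vs.span_scale T) auto
      finally show "v \<in> vs.span ?T" using w by simp
    qed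
    then have "card (e ` {..d}) \<le> card ?T" using conjunct2[OF vs.independent_span_bound[OF _ indep]] by (metis finite_atMost finite_Diff finite_imageI)
    also have "\<dots> \<le> card ({..d} - {p})" by (intro card_image_le) auto
    finally show False using pd by (simp add: card_image[OF inje])
  qed
qed

lemma not_eigenvalue_OX:
  assumes "v \<in> Ospace d" "\<And>i. i \<le> d \<Longrightarrow> Otheta a d i \<noteq> t" "OX a d v = (\<lambda>x. t * v x)"
  shows "v = (\<lambda>_. 0)"
proof -
  have "v i = 0" for i
  proof (induction i)
    case 0 show ?case using assms(2)[of 0] fun_cong[OF assms(3), of 0] by (auto simp: OX_def)
  next
    case (Suc i) then show ?case
      using assms(2)[of "Suc i"] fun_cong[OF assms(3), of "Suc i"] OspaceD[OF assms(1), of "Suc i"]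
      by (cases "Suc i \<le> d") (auto simp: OX_def)
  qed
  then show ?thesis by auto
qed

lemma not_eigenvalue_OY:
  assumes "v \<in> Ospace d" "\<And>i. i \<le> d \<Longrightarrow> Otheta b d i \<noteq> t" "OY a b c d v = (\<lambda>x. t * v x)"
  shows "v = (\<lambda>_. 0)"
proof -
  \<comment> \<open>Y is upper bidiagonal, so the entries are eliminated from the top index
    downwards.\<close>
  have "i \<le> d \<Longrightarrow> v (d - i) = 0" for i
  proof (induction i)
    case 0 show ?case using assms(2)[of d] fun_cong[OF assms(3), of d] by (auto simp: OY_def)
  next
    case (Suc i)
    then have "Suc (d - Suc i) = d - i" "d - Suc i < d" by simp_all
    then show ?case
      using Suc assms(2)[of "d - Suc i"] fun_cong[OF assms(3), of "d - Suc i"] by (auto simp: OY_def)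
  qed
  then have "v i = 0" for i using OspaceD[OF assms(1), of i] by (metis diff_diff_cancel diff_le_self not_le)
  then show ?thesis by auto
qed

text \<open>In the two conditions \<open>psi\<close>, the first factors say together that the
  diagonal entries theta*_0, ..., theta*_d of Y are pairwise distinct. The second factors are the
  parameter-dependent factors of phi_i with (a, b, c) replaced by (-a, b, -c). Both arise from
  factoring a single coefficient.\<close>

lemma O_irreducible:
  assumes ev: "even d"
    and phi: "\<And>i. 1 \<le> i \<Longrightarrow> i \<le> d \<Longrightarrow> Ophi a b c d i \<noteq> 0"
    and psi: "\<And>i. 1 \<le> i \<Longrightarrow> i \<le> d \<Longrightarrow> even i \<Longrightarrow>
       (2 * b - of_nat d - 1 + of_nat i) * (2 * a + 2 * c - 2 * b + of_nat d + 1 - 2 * of_nat i) \<noteq> 0"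
      "\<And>i. 1 \<le> i \<Longrightarrow> i \<le> d \<Longrightarrow> odd i \<Longrightarrow>
       (2 * b + of_nat i) * (2 * a - 2 * c - 2 * b + of_nat d + 1 - 2 * of_nat i) \<noteq> 0"
    and S: "S \<subseteq> Ospace d" "(\<lambda>_. 0) \<in> S" "\<And>u w. u \<in> S \<Longrightarrow> w \<in> S \<Longrightarrow> (\<lambda>x. u x + w x) \<in> S"
      "\<And>u k. u \<in> S \<Longrightarrow> (\<lambda>x. k * u x) \<in> S" "\<And>u. u \<in> S \<Longrightarrow> OX a d u \<in> S" "\<And>u. u \<in> S \<Longrightarrow> OY a b c d u \<in> S"
  shows "S = {\<lambda>_. 0} \<or> S = Ospace d"
proof (rule disjCI)
  assume "S \<noteq> Ospace d"
  show "S = {\<lambda>_. 0}"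
  proof (rule ccontr)
    assume "S \<noteq> {\<lambda>_. 0}"
    define Top where "Top n u \<longleftrightarrow> u \<in> S \<and> u \<noteq> (\<lambda>_. 0) \<and> (\<forall>i>n. u i = 0)" for n u
    have "\<exists>n u. Top n u" using \<open>S \<noteq> {\<lambda>_. 0}\<close> S(1,2) unfolding Top_def Ospace_def by blast
    define n where "n = (LEAST n. \<exists>u. Top n u)"
    obtain u where u: "Top n u" using LeastI_ex[OF \<open>\<exists>n u. Top n u\<close>] unfolding n_def by blast
    have least: "n \<le> j" if "Top j w" for j w unfolding n_def using that by (intro Least_le) blast
    have comb: "(\<lambda>x. F x - t * G x) \<in> S" if "F \<in> S" "G \<in> S" for F G t
      using S(3)[OF that(1) S(4)[OF that(2), of "-t"]] by simp
    have low: "w = (\<lambda>_. 0)" if "w \<in> S" "\<And>i. i \<ge> n \<Longrightarrow> w i = 0" for w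
    proof (rule ccontr)
      assume ne: "w \<noteq> (\<lambda>_. 0)"
      then have "n > 0" using that(2) by (cases n) (auto simp: fun_eq_iff)
      then have "Top (n - 1) w" using that ne by (auto simp: Top_def)
      then show False using least \<open>n > 0\<close> by fastforce
    qed
    have un: "u n \<noteq> 0"
      using low[of u] u unfolding Top_def by (metis le_neq_implies_less)
    have nd: "n \<le> d" using un u S(1) unfolding Top_def Ospace_def by (metis (mono_tags, lifting) in_mono mem_Collect_eq not_le)
    have uS: "u \<in> S" and u0: "\<And>i. i > n \<Longrightarrow> u i = 0" using u by (auto simp: Top_def)
    have uO: "u \<in> Ospace d" using uS S(1) by blast
    let ?s = "Otheta b d" and ?p = "Ophi a b c d"
    \<comment> \<open>Subtracting theta*_n u cancels the top entry of Y u, and minimality of n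
      leaves only 0.\<close>
    have "OY a b c d u i - ?s n * u i = 0" if "i \<ge> n" for i
      using that u0 nd by (cases "i = n") (auto simp: OY_def)
    then have eig: "(\<lambda>x. OY a b c d u x - ?s n * u x) = (\<lambda>_. 0)"
      by (intro low comb S uS)
    then have eig: "OY a b c d u i = ?s n * u i" for i by (auto simp: fun_eq_iff)
    show False
    proof (cases n)
      case 0
      \<comment> \<open>Here u is a multiple of the first unit vector, and X e_k = theta_k e_k +
        e_{k+1} yields the remaining ones successively.\<close>
      have "{v. \<forall>i>k. v i = 0} \<subseteq> S" if "k \<le> d" for k using that
      proof (induction k)
        case 0
        { fix v :: "nat \<Rightarrow> complex" assume "\<forall>i>0. v i = 0"
          then have "v = (\<lambda>x. (v 0 / u 0) * u x)" using un u0 \<open>n = 0\<close>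
            by (intro ext, case_tac "x = 0") auto
          then have "v \<in> S" using S(4)[OF uS] by metis }
        then show ?case by blast
      next
        case (Suc k)
        { fix v :: "nat \<Rightarrow> complex" assume v: "\<forall>i>Suc k. v i = 0"
          define e where "e = (\<lambda>i. if i = k then v (Suc k) else 0)"
          have "e \<in> S" using Suc unfolding e_def by auto
          then have "OX a d e \<in> S" using S by blast
          moreover have "(\<lambda>x. v x - 1 * OX a d e x) \<in> {v. \<forall>i>k. v i = 0}"
            using v Suc.prems by (auto simp: OX_def e_def)
          then have "(\<lambda>x. v x - 1 * OX a d e x) \<in> S" using Suc by auto
          ultimately have "v \<in> S" using S(3)[of "\<lambda>x. v x - 1 * OX a d e x" "OX a d e"] by simp }
        then show ?case by blast
      qed
      from this[of d] show False using \<open>S \<noteq> Ospace d\<close> S(1) unfolding Ospace_def by auto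
    next
      case (Suc j)
      \<comment> \<open>X raises the top index to n + 1; the factors Y - theta*_n and Y -
        theta*_{n+1} applied afterwards cancel the entries at n + 1 and n. The result has its
        support below n, so it is 0, and its entry at n - 1 gives the equation
        \<open>yj\<close>.\<close>
      define w where "w = OX a d u"
      define z where "z = (\<lambda>x. OY a b c d w x - ?s n * w x)"
      define y where "y = (\<lambda>x. OY a b c d z x - ?s (Suc n) * z x)"
      have wS: "w \<in> S" unfolding w_def by (intro S uS)
      have zS: "z \<in> S" unfolding z_def by (intro comb S wS)
      have yS: "y \<in> S" unfolding y_def by (intro comb S zS)
      have w0: "w i = 0" if "i > Suc n" for i using that u0 unfolding w_def OX_def by auto
      have z0: "z i = 0" if "i > Suc n" for i using that w0 unfolding z_def OY_def by auto
      have zn: "z (Suc n) = (?s (Suc n) - ?s n) * w (Suc n)" 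
        using w0 OspaceD[of w d "Suc n"] wS S(1) unfolding z_def OY_def by (auto simp: algebra_simps)
      have zn': "z n = ?p (Suc n) * w (Suc n)"
        using nd OY_apply(1)[of d w n] ev wS S(1) unfolding z_def by auto
      have y0: "y i = 0" if i: "i \<ge> n" for i
      proof -
        consider "i > Suc n" | "i = Suc n" | "i = n" using i by linarith
        then show ?thesis
        proof cases
          case 1 then show ?thesis using z0 unfolding y_def OY_def by auto
        next
          case 2 then show ?thesis using z0 OspaceD[of z d "Suc n"] zS S(1) unfolding y_def OY_def by auto
        next
          case 3 then show ?thesis
            using nd OY_apply(1)[of d z n a b c] ev zS S(1) zn zn' unfolding y_def by (auto simp: algebra_simps)
        qed
      qed
      have "y j = 0" using low[OF yS y0] by simp
      obtain m where m: "d = 2 * m" using ev by blast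
      define U Q P where "U = u n" and "Q = u j" and "P = (if j = 0 then 0 else u (j - 1))"
      have wj: "w j = Otheta a d j * Q + P" and wn: "w n = Otheta a d n * U + Q"
        using nd Suc unfolding w_def U_def Q_def P_def OX_def by auto
      have wn1: "?p (Suc n) * w (Suc n) = ?p (Suc n) * U"
        using nd ev u0 by (cases "n = d") (auto simp: w_def OX_def U_def)
      have zj: "z j = (?s j - ?s n) * w j + ?p n * w n"
        using nd Suc unfolding z_def OY_def by (auto simp: algebra_simps)
      have yj: "(?s j - ?s (Suc n)) * z j + ?p n * z n = 0"
        using nd Suc \<open>y j = 0\<close> unfolding y_def OY_def by (auto simp: algebra_simps)
      \<comment> \<open>The eigenvector equation in rows n - 1 and n - 2 ties the two lower entries
        Q and P to U.\<close>
      have e1: "(?s n - ?s j) * Q = ?p n * U"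
        using eig[of j] nd Suc unfolding OY_def U_def Q_def by (auto simp: algebra_simps)
      have e2: "?p j * Q = (if even n then 2 else -2) * P"
      proof (cases j)
        case 0 then show ?thesis by (simp add: P_def)
      next
        case (Suc l)
        have "?s n - ?s l = (if even n then 2 else -2)"
          using \<open>n = Suc j\<close> Suc by (simp add: Otheta_alt)
        then show ?thesis
          using eig[of l] nd \<open>n = Suc j\<close> Suc unfolding OY_def P_def Q_def by (auto simp: algebra_simps)
      qed
      have U0: "?p n * U \<noteq> 0" using un phi nd Suc unfolding U_def by auto
      let ?r = "if even n then 2 else -2 :: complex" and ?D = "?s n - ?s j"
      have r: "?s j - ?s (Suc n) = ?r"
        unfolding Suc by (simp add: Otheta_alt)
      \<comment> \<open>Multiplying by \<open>?D\<close> lets \<open>e1\<close> replace every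
        \<open>?D * Q\<close> by a multiple of U, so that the nonzero \<open>?p n * U\<close> can be
        cancelled.\<close>
      have "0 = ?D * (?r * ((?s j - ?s n) * (Otheta a d j * Q + P) + ?p n * (Otheta a d n * U + Q)) + ?p n * (?p (Suc n) * U))"
        using yj unfolding zj zn' wn1 wj wn r by simp
      also have "\<dots> = - ?r * ?D * Otheta a d j * (?D * Q) - ?D * ?D * (?r * P) + ?r * ?p n * Otheta a d n * ?D * U
          + ?r * ?p n * (?D * Q) + ?p n * ?p (Suc n) * ?D * U"
        by algebra
      also have "?r * P = ?p j * Q" using e2 by simp
      also have "?D * ?D * (?p j * Q) = ?D * ?p j * (?D * Q)" by algebra
      also have "- ?r * ?D * Otheta a d j * (?D * Q) - ?D * ?p j * (?D * Q) + ?r * ?p n * Otheta a d n * ?D * U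
          + ?r * ?p n * (?D * Q) + ?p n * ?p (Suc n) * ?D * U
        = (?p n * U) * (?D * (?r * (Otheta a d n - Otheta a d j) + ?p (Suc n) - ?p j) + ?r * ?p n)"
        unfolding e1 by algebra
      finally have psi0: "?D * (?r * (Otheta a d n - Otheta a d j) + ?p (Suc n) - ?p j) + ?r * ?p n = 0"
        using U0 by (metis mult_eq_0_iff)
      have par: "(\<exists>l. j = 2 * l) \<or> (\<exists>l. j = Suc (2 * l))" by presburger
      then show False
      proof (elim disjE exE)
        fix l assume l: "j = 2 * l"
        have "((2 * b + of_nat n) * (2 * a - 2 * c - 2 * b + of_nat d + 1 - 2 * of_nat n)) = 0"
          using psi0 unfolding Suc l m by (simp add: parity_rules) algebra
        then show False using psi(2)[of n] nd l Suc by auto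
      next
        fix l assume l: "j = Suc (2 * l)"
        have "((2 * b - of_nat d - 1 + of_nat n) * (2 * a + 2 * c - 2 * b + of_nat d + 1 - 2 * of_nat n)) = 0"
          using psi0 unfolding Suc l m by (simp add: parity_rules) algebra
        then show False using psi(1)[of n] nd l Suc by auto
      qed
    qed
  qed
qed

section \<open>Homomorphisms from O to a module with the same anticommutator relations\<close>

locale split_module =
  fixes M :: "nat bimod" and a b c :: complex and m :: nat and v0 :: "nat \<Rightarrow> complex"
  assumes car: "car M = Ospace (2 * m)"
    and linX: "lin_on UNIV (opX M)" and linY: "lin_on UNIV (opY M)"
    and closed: "\<And>v. v \<in> Ospace (2 * m) \<Longrightarrow> opX M v \<in> Ospace (2 * m)"
    and relXY: "\<And>v i. v \<in> Ospace (2 * m) \<Longrightarrow> opX M (opY M v) i + opY M (opX M v) i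
        = opZ M v i + (2 * a * b - c * (2 * of_nat m + 1)) * v i"
    and relZX: "\<And>v i. v \<in> Ospace (2 * m) \<Longrightarrow> opZ M (opX M v) i + opX M (opZ M v) i
        = opY M v i + (2 * c * a - b * (2 * of_nat m + 1)) * v i"
    and v0: "v0 \<in> Ospace (2 * m)" "v0 \<noteq> (\<lambda>_. 0)"
    and Yv0: "opY M v0 = (\<lambda>x. Otheta b (2 * m) 0 * v0 x)"
    and top: "\<And>v. v \<in> Ospace (2 * m) \<Longrightarrow> opY M v = (\<lambda>x. Otheta b (2 * m) (Suc (2 * m)) * v x) \<Longrightarrow> v = (\<lambda>_. 0)"
begin

abbreviation "vec \<equiv> split_vec (opX M) a (2 * m) v0"

text \<open>The coefficients 1 put the right-hand side into the shape to which \<open>lin_comb3\<close> applies.\<close>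

lemma relXY': assumes "v \<in> Ospace (2 * m)" shows "opZ M v = (\<lambda>i. 1 * opX M (opY M v) i + 1 * opY M (opX M v) i
     + (-(2 * a * b - c * (2 * of_nat m + 1))) * v i)"
  using relXY[OF assms] by (simp add: algebra_simps fun_eq_iff)

lemma cubic: 
  assumes "v \<in> Ospace (2 * m)"
  shows "opX M (opX M (opY M v)) x + 2 * opX M (opY M (opX M v)) x + opY M (opX M (opX M v)) x
        - 2 * (2 * a * b - c * (2 * of_nat m + 1)) * opX M v x = opY M v x + (2 * c * a - b * (2 * of_nat m + 1)) * v x"
  using relZX[OF assms, of x] unfolding relXY'[OF assms] relXY'[OF closed[OF assms]] lin_comb3[OF linX]
  by (simp add: algebra_simps)

text \<open>With t = theta*_0, the relation for {Y, Z} applied to v_0 says that ((Y + t)^2 - 1) v_1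
  is a multiple of v_0. The roots are theta*_1 = -t - 1 and 1 - t; excluding the second as an
  eigenvalue forces the formula.\<close>

lemma opY_vec_1:
  assumes relYZ: "\<And>v i. v \<in> Ospace (2 * m) \<Longrightarrow> opY M (opZ M v) i + opZ M (opY M v) i
        = opX M v i + (2 * b * c - a * (2 * of_nat m + 1)) * v i"
    and closedY: "\<And>v. v \<in> Ospace (2 * m) \<Longrightarrow> opY M v \<in> Ospace (2 * m)"
    and ne: "\<And>v. v \<in> Ospace (2 * m) \<Longrightarrow> opY M v = (\<lambda>x. (1 - (b - of_nat m)) * v x) \<Longrightarrow> v = (\<lambda>_. 0)"
  shows "opY M (vec 1) = (\<lambda>x. Otheta b (2 * m) 1 * vec 1 x + Ophi a b c (2 * m) 1 * v0 x)"
proof -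
  define t r v1 where "t = b - of_nat m" and "r = a - of_nat m" and "v1 = vec 1"
  let ?k = "2 * a * b - c * (2 * of_nat m + 1)" and ?p = "Ophi a b c (2 * m) 1"
  define y1 where "y1 = opY M v1"
  have v1O: "v1 \<in> Ospace (2 * m)"
    using OspaceD[OF v0(1)] OspaceD[OF closed[OF v0(1)]] by (simp add: v1_def Ospace_def)
  have Y0: "opY M v0 = (\<lambda>x. t * v0 x + 0 * v0 x)"
    using Yv0 by (simp add: t_def parity_rules)
  have X0: "opX M v0 = (\<lambda>x. 1 * v1 x + r * v0 x)"
    by (simp add: v1_def r_def parity_rules)
  have XY0: "opX M (opY M v0) = (\<lambda>x. t * v1 x + t * r * v0 x)"
    unfolding Y0 lin_comb2[OF linX] X0 by (simp add: algebra_simps)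
  have YX0: "opY M (opX M v0) = (\<lambda>x. y1 x + r * t * v0 x)"
    unfolding X0 lin_comb2[OF linY] Y0 y1_def by (simp add: algebra_simps)
  have Z0: "opZ M v0 = (\<lambda>x. 1 * y1 x + t * v1 x + (2 * t * r - ?k) * v0 x)"
    unfolding relXY'[OF v0(1)] XY0 YX0 by (simp add: algebra_simps)
  have XYY0: "opX M (opY M (opY M v0)) = (\<lambda>x. t * t * v1 x + t * t * r * v0 x)"
    unfolding Y0 lin_comb2[OF linY] Y0 lin_comb2[OF linX] X0 by (simp add: algebra_simps)
  have YXY0: "opY M (opX M (opY M v0)) = (\<lambda>x. t * y1 x + t * r * t * v0 x)"
    unfolding XY0 unfolding lin_comb2[OF linY] Y0 y1_def by (simp add: algebra_simps)
  have rel: "opY M y1 x + t * y1 x + (2 * t * r - ?k) * t * v0 x + t * t * v1 x + t * t * r * v0 x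
      + t * y1 x + t * r * t * v0 x - ?k * t * v0 x = v1 x + r * v0 x + (2 * b * c - a * (2 * of_nat m + 1)) * v0 x" for x
    using relYZ[OF v0(1), of x]
    unfolding relXY'[OF closedY[OF v0(1)]] XYY0 YXY0 Z0 lin_comb3[OF linY]
    unfolding Y0 X0 y1_def[symmetric] by (simp add: algebra_simps)
  \<comment> \<open>The defect of the desired formula; by \<open>rel\<close> it satisfies Y P = (1 -
    t) P.\<close>
  define P where "P = (\<lambda>x. 1 * y1 x + (t + 1) * v1 x + (- ?p) * v0 x)"
  have "P = (\<lambda>_. 0)"
  proof (rule ne)
    show "P \<in> Ospace (2 * m)"
      using OspaceD[OF v0(1)] OspaceD[OF v1O] OspaceD[OF closedY[OF v1O]] by (simp add: P_def y1_def Ospace_def)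
    show "opY M P = (\<lambda>x. (1 - (b - of_nat m)) * P x)"
    proof
      fix x
      have "opY M P x = opY M y1 x + (t + 1) * y1 x - ?p * t * v0 x"
        unfolding P_def lin_comb3[OF linY] Y0 y1_def[symmetric] by simp
      also have "\<dots> = (1 - t) * P x"
        using rel[of x] unfolding P_def One_nat_def parity_rules t_def r_def by algebra
      finally show "opY M P x = (1 - (b - of_nat m)) * P x" by (simp add: t_def)
    qed
  qed
  then have P0: "P x = 0" for x by simp
  have "y1 x = Otheta b (2 * m) 1 * v1 x + ?p * v0 x" for x
    using P0[of x] unfolding P_def One_nat_def parity_rules t_def by algebra
  then show ?thesis by (simp add: y1_def v1_def fun_eq_iff)
qed

text \<open>The i-th unit vector goes to v_i. What could fail is X on the last basis vector, where O
  has no successor. As phi_{d+1} = 0, the vector v_{d+1} satisfies the eigenvector equation of Y for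
  theta*_{d+1}, so \<open>top\<close> makes it 0.\<close>

lemma hom_exists:
  assumes Yv1: "opY M (vec 1) = (\<lambda>x. Otheta b (2 * m) 1 * vec 1 x + Ophi a b c (2 * m) 1 * v0 x)"
  obtains f where "bim_hom (Omod a b c (2 * m)) M f" "lin_on UNIV f" "v0 \<in> f ` Ospace (2 * m)"
proof -
  note vec = Y_split_vec[OF linX linY closed cubic v0(1) Yv0 Yv1]
  let ?d = "2 * m"
  define f where "f u = (\<lambda>x. \<Sum>i\<le>?d. u i * vec i x)" for u :: "nat \<Rightarrow> complex"
  have f_in: "f u \<in> Ospace ?d" for u
    using vec(1) by (auto simp: f_def Ospace_def)
  have last: "vec (Suc ?d) = (\<lambda>_. 0)"
    using vec(1)[of "Suc ?d"] vec(2)[of "Suc ?d"] by (intro top) (simp_all del: split_vec.simps)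
  have fX: "f (OX a ?d u) = opX M (f u)" for u
  proof
    fix x
    have "opX M (f u) x = (\<Sum>i\<le>?d. u i * vec (Suc i) x) + (\<Sum>i\<le>?d. Otheta a ?d i * u i * vec i x)"
      unfolding f_def lin_sum[OF linX] by (simp add: algebra_simps flip: sum.distrib)
    also have "(\<Sum>i\<le>?d. u i * vec (Suc i) x) = (\<Sum>i\<le>Suc ?d. (if i = 0 then 0 else u (i - 1)) * vec i x)"
      by (subst sum.atMost_Suc_shift) simp
    also have "\<dots> = (\<Sum>i\<le>?d. (if i = 0 then 0 else u (i - 1)) * vec i x)"
      using last by (simp del: split_vec.simps)
    finally show "f (OX a ?d u) x = opX M (f u) x"
      by (simp add: f_def OX_def algebra_simps flip: sum.distrib cong: if_cong)
  qed
  have fY: "f (OY a b c ?d u) = opY M (f u)" if u: "u \<in> Ospace ?d" for u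
  proof
    fix x
    have "opY M (f u) x = (\<Sum>i\<le>?d. Otheta b ?d i * u i * vec i x) + (\<Sum>i\<le>?d. u i * Ophi a b c ?d i * vec (i - 1) x)"
      unfolding f_def lin_sum[OF linY] by (simp add: vec(2)) (simp add: algebra_simps sum.distrib)
    also have "(\<Sum>i\<le>?d. u i * Ophi a b c ?d i * vec (i - 1) x) = (\<Sum>i\<le>Suc ?d. u i * Ophi a b c ?d i * vec (i - 1) x)"
      using OspaceD[OF u] by simp
    also have "\<dots> = (\<Sum>i\<le>?d. u (Suc i) * Ophi a b c ?d (Suc i) * vec i x)"
      by (subst sum.atMost_Suc_shift) simp
    finally have "opY M (f u) x = (\<Sum>i\<le>?d. (Otheta b ?d i * u i + Ophi a b c ?d (Suc i) * u (Suc i)) * vec i x)"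
      by (simp add: algebra_simps flip: sum.distrib)
    then show "f (OY a b c ?d u) x = opY M (f u) x"
      using OY_apply(1)[OF _ u] by (simp add: f_def)
  qed
  have lf: "lin_on UNIV f"
    by (auto simp: lin_on_def f_def algebra_simps sum.distrib sum_distrib_left)
  have fZ: "f (opZ (Omod a b c ?d) u) = opZ M (f u)" if u: "u \<in> Ospace ?d" for u
  proof -
    have "opZ (Omod a b c ?d) u = (\<lambda>i. 1 * OX a ?d (OY a b c ?d u) i + 1 * OY a b c ?d (OX a ?d u) i
        + (-(2 * a * b - c * (2 * of_nat m + 1))) * u i)"
      by (simp add: Omod_def fun_eq_iff algebra_simps)
    then have "f (opZ (Omod a b c ?d) u) = (\<lambda>i. 1 * f (OX a ?d (OY a b c ?d u)) i + 1 * f (OY a b c ?d (OX a ?d u)) i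
        + (-(2 * a * b - c * (2 * of_nat m + 1))) * f u i)"
      by (simp only: lin_comb3[OF lf])
    then show ?thesis by (simp add: fX fY u relXY'[OF f_in])
  qed
  have "f (\<lambda>i. if i = 0 then 1 else 0) = v0"
    by (simp add: f_def if_distrib[of "\<lambda>t. t * _"] cong: if_cong)
  then have "v0 \<in> f ` Ospace ?d" by (force simp: Ospace_def)
  moreover have "bim_hom (Omod a b c ?d) M f"
    unfolding bim_hom_def using lf fX fY fZ f_in by (auto simp: Omod_def car Ospace_def lin_on_def)
  ultimately show thesis using lf that by blast
qed

lemma iso:
  assumes Yv1: "opY M (vec 1) = (\<lambda>x. Otheta b (2 * m) 1 * vec 1 x + Ophi a b c (2 * m) 1 * v0 x)"
    and irr: "bim_irred M"
  shows "bim_iso M (Omod a b c (2 * m))"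
proof -
  obtain f where f: "bim_hom (Omod a b c (2 * m)) M f" and lin: "lin_on UNIV f" and im: "v0 \<in> f ` Ospace (2 * m)"
    using hom_exists[OF Yv1] by blast
  let ?O = "Omod a b c (2 * m)"
  have carO: "car ?O = Ospace (2 * m)" by (simp add: Omod_def Ospace_def)
  have opO: "opX ?O v \<in> Ospace (2 * m)" "opY ?O v \<in> Ospace (2 * m)" "v \<in> Ospace (2 * m) \<Longrightarrow> opZ ?O v \<in> Ospace (2 * m)" for v
    by (simp_all add: opZ_Omod) (simp_all add: Omod_def)
  note fop = f[unfolded bim_hom_def, THEN conjunct2, THEN conjunct2, unfolded carO]
  have add: "f (\<lambda>x. u x + w x) = (\<lambda>y. f u y + f w y)" and sc: "f (\<lambda>x. k * u x) = (\<lambda>y. k * f u y)" for u w k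
    using lin by (auto simp: lin_on_def)
  let ?S = "f ` Ospace (2 * m)"
  have "?S = {\<lambda>_. 0} \<or> ?S = car M"
  proof (rule irr[unfolded bim_irred_def, THEN conjunct2, rule_format], intro conjI ballI allI)
    show "?S \<subseteq> car M" using f unfolding bim_hom_def carO by auto
    show "(\<lambda>_. 0) \<in> ?S" using lin_zero[OF lin] by (force simp: Ospace_def)
  next
    fix u w assume "u \<in> ?S" "w \<in> ?S"
    then obtain u' w' where "u' \<in> Ospace (2 * m)" "w' \<in> Ospace (2 * m)" "u = f u'" "w = f w'" by blast
    then show "(\<lambda>x. u x + w x) \<in> ?S"
      by (intro image_eqI[of _ _ "\<lambda>x. u' x + w' x"]) (auto simp: add Ospace_def)
  next
    fix u k assume "u \<in> ?S"
    then obtain u' where "u' \<in> Ospace (2 * m)" "u = f u'" by blast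
    then show "(\<lambda>x. k * u x) \<in> ?S"
      by (intro image_eqI[of _ _ "\<lambda>x. k * u' x"]) (auto simp: sc Ospace_def)
  next
    fix u assume "u \<in> ?S"
    then obtain u' where u': "u' \<in> Ospace (2 * m)" "u = f u'" by blast
    then show "opX M u \<in> ?S" "opY M u \<in> ?S" "opZ M u \<in> ?S"
      using fop opO by (metis image_eqI)+
  qed
  then have onto: "?S = Ospace (2 * m)" using im v0 car by auto
  have ker: "u = (\<lambda>_. 0)" if "u \<in> Ospace (2 * m)" "f u = (\<lambda>_. 0)" for u
    using linear_surj_inj[OF lin onto] that by blast
  have inj: "inj_on f (Ospace (2 * m))"
  proof (rule inj_onI)
    fix u w assume uw: "u \<in> Ospace (2 * m)" "w \<in> Ospace (2 * m)" "f u = f w"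
    have "(\<lambda>x. 1 * u x + (-1) * w x) = (\<lambda>_. 0)"
    proof (rule ker)
      show "(\<lambda>x. 1 * u x + (-1) * w x) \<in> Ospace (2 * m)" using uw by (simp add: Ospace_def)
      show "f (\<lambda>x. 1 * u x + (-1) * w x) = (\<lambda>_. 0)"
        unfolding lin_comb2[OF lin] uw(3) by simp
    qed
    then show "u = w" by (auto simp: fun_eq_iff)
  qed
  \<comment> \<open>The isomorphism is wanted from M to O, so the homomorphism property is
    transported to the inverse.\<close>
  define g where "g = inv_into (Ospace (2 * m)) f"
  have gf: "g (f u) = u" if "u \<in> Ospace (2 * m)" for u using inj that by (simp add: g_def)
  have fg: "f (g w) = w" "g w \<in> Ospace (2 * m)" if "w \<in> Ospace (2 * m)" for w
    using onto that by (auto simp: g_def f_inv_into_f inv_into_into)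
  have geq: "g w = u" if "u \<in> Ospace (2 * m)" "f u = w" for u w using gf that by auto
  have "bim_hom M ?O g"
    unfolding bim_hom_def carO car lin_on_def
  proof (intro conjI ballI allI)
    fix w w' k assume w: "w \<in> Ospace (2 * m)" "w' \<in> Ospace (2 * m)"
    show "g (\<lambda>x. w x + w' x) = (\<lambda>y. g w y + g w' y)"
      using fg[OF w(1)] fg[OF w(2)] by (intro geq) (auto simp: add, auto simp: Ospace_def)
    show "g (\<lambda>x. k * w x) = (\<lambda>y. k * g w y)"
      using fg[OF w(1)] by (intro geq) (auto simp: sc, auto simp: Ospace_def)
  next
    fix w assume w: "w \<in> Ospace (2 * m)"
    show "g w \<in> Ospace (2 * m)" using fg w by blast
    show "g (opX M w) = opX ?O (g w)" "g (opY M w) = opY ?O (g w)" "g (opZ M w) = opZ ?O (g w)"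
      using fg[OF w] fop opO by (auto intro!: geq)
  qed
  moreover have "bij_betw g (Ospace (2 * m)) (Ospace (2 * m))"
    using inj onto unfolding g_def by (metis bij_betw_def bij_betw_inv_into)
  ultimately show ?thesis unfolding bim_iso_def carO car by blast
qed

end

section \<open>Isomorphisms between twists of the modules O\<close>

lemma lin_on_scale_comp:
  assumes "lin_on UNIV F"
  shows "lin_on UNIV (\<lambda>v x. s * F v x)"
  using assms by (auto simp: lin_on_def algebra_simps)

lemma lin_on_opZ: "lin_on UNIV (opZ (Omod a b c d))"
proof -
  note [simp] = lin_comb2[OF lin_on_OX, of a d 1 _ 1, simplified] lin_comb2[OF lin_on_OY, of a b c d 1 _ 1, simplified]
    lin_comb2[OF lin_on_OX, of a d _ _ 0, simplified] lin_comb2[OF lin_on_OY, of a b c d _ _ 0, simplified]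
  show ?thesis by (auto simp: lin_on_def Omod_def algebra_simps fun_eq_iff)
qed

lemma twist_ops:
  "car (twist e \<sigma> M) = car M"
  "opX (twist e \<sigma> M) = (\<lambda>v x. of_int (if \<sigma> 1 = 1 then fst e else if \<sigma> 1 = 2 then snd e else fst e * snd e) * genOf M (\<sigma> 1) v x)"
  "opY (twist e \<sigma> M) = (\<lambda>v x. of_int (if \<sigma> 2 = 1 then fst e else if \<sigma> 2 = 2 then snd e else fst e * snd e) * genOf M (\<sigma> 2) v x)"
  "opZ (twist e \<sigma> M) = (\<lambda>v x. of_int (if \<sigma> 3 = 1 then fst e else if \<sigma> 3 = 2 then snd e else fst e * snd e) * genOf M (\<sigma> 3) v x)"
  by (simp_all add: twist_def Let_def)

lemma car_Omod: "car (Omod a b c d) = Ospace d"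
  by (simp add: Omod_def Ospace_def)

lemma opX_Omod: "opX (Omod a b c d) = OX a d" and opY_Omod: "opY (Omod a b c d) = OY a b c d"
  by (simp_all add: Omod_def)

lemma twist_W1:
  fixes a b c :: complex and d :: nat
  defines "W \<equiv> twist (-1, 1) perm13 (Omod a b c d)"
  shows "car W = Ospace d" "opX W = (\<lambda>v x. - 1 * opZ (Omod a b c d) v x)" "opY W = (\<lambda>v x. 1 * OY a b c d v x)" "opZ W = (\<lambda>v x. - 1 * OX a d v x)"
  unfolding W_def twist_ops by (simp_all add: perm13_def genOf_def car_Omod opX_Omod opY_Omod)

lemma twist_W2:
  fixes a b c :: complex and d :: nat
  defines "W \<equiv> twist (1, -1) perm13 (Omod a b c d)"
  shows "car W = Ospace d" "opX W = (\<lambda>v x. - 1 * opZ (Omod a b c d) v x)" "opY W = (\<lambda>v x. - 1 * OY a b c d v x)" "opZ W = (\<lambda>v x. 1 * OX a d v x)"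
  unfolding W_def twist_ops by (simp_all add: perm13_def genOf_def car_Omod opX_Omod opY_Omod)

lemma twist_W3:
  fixes a b c :: complex and d :: nat
  defines "W \<equiv> twist (1, -1) perm132 (Omod a b c d)"
  shows "car W = Ospace d" "opX W = (\<lambda>v x. - 1 * opZ (Omod a b c d) v x)" "opY W = (\<lambda>v x. 1 * OX a d v x)" "opZ W = (\<lambda>v x. - 1 * OY a b c d v x)"
  unfolding W_def twist_ops by (simp_all add: perm132_def genOf_def car_Omod opX_Omod opY_Omod)

text \<open>Irreducibility of a twist can be tested on O: up to a scalar, \<open>OX\<close> and
  \<open>OY\<close> are among the operators of the twist, so its submodules are stable under
  both.\<close>

lemma bim_irredI:
  assumes car: "car M = Ospace d"
    and F: "F \<in> {opX M, opY M, opZ M}" "\<And>u. OX a d u = (\<lambda>x. s * F u x)"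
    and G: "G \<in> {opX M, opY M, opZ M}" "\<And>u. OY a b c d u = (\<lambda>x. t * G u x)"
    and "even d"
    and phi: "\<And>i. 1 \<le> i \<Longrightarrow> i \<le> d \<Longrightarrow> Ophi a b c d i \<noteq> 0"
    and psi: "\<And>i. 1 \<le> i \<Longrightarrow> i \<le> d \<Longrightarrow> even i \<Longrightarrow>
       (2 * b - of_nat d - 1 + of_nat i) * (2 * a + 2 * c - 2 * b + of_nat d + 1 - 2 * of_nat i) \<noteq> 0"
      "\<And>i. 1 \<le> i \<Longrightarrow> i \<le> d \<Longrightarrow> odd i \<Longrightarrow>
       (2 * b + of_nat i) * (2 * a - 2 * c - 2 * b + of_nat d + 1 - 2 * of_nat i) \<noteq> 0"
  shows "bim_irred M"
  unfolding bim_irred_def car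
proof (intro conjI allI impI)
  have "(\<lambda>i. if i = 0 then 1 else 0) \<in> Ospace d" by (simp add: Ospace_def)
  moreover have "(\<lambda>i. if i = 0 then 1 else 0 :: complex) \<noteq> (\<lambda>_. 0)" by (auto simp: fun_eq_iff)
  ultimately show "Ospace d \<noteq> {\<lambda>_. 0}" by blast
  fix S assume S: "S \<subseteq> Ospace d \<and> (\<lambda>_. 0) \<in> S \<and> (\<forall>u\<in>S. \<forall>w\<in>S. (\<lambda>x. u x + w x) \<in> S)
        \<and> (\<forall>u\<in>S. \<forall>c::complex. (\<lambda>x. c * u x) \<in> S) \<and> (\<forall>u\<in>S. opX M u \<in> S \<and> opY M u \<in> S \<and> opZ M u \<in> S)"
  have "F u \<in> S" "G u \<in> S" if "u \<in> S" for u using S that F(1) G(1) by auto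
  then have "OX a d u \<in> S" "OY a b c d u \<in> S" if "u \<in> S" for u
    unfolding F(2) G(2) using S that by auto
  then show "S = {\<lambda>_. 0} \<or> S = Ospace d"
    using S by (intro O_irreducible[of d a b c] phi psi \<open>even d\<close>) simp_all
qed

lemma Omod_relations:
  assumes "v \<in> Ospace (2 * m)"
  shows "OX a (2 * m) (OY a b c (2 * m) v) i + OY a b c (2 * m) (OX a (2 * m) v) i = opZ (Omod a b c (2 * m)) v i + (2 * a * b - c * (2 * of_nat m + 1)) * v i"
    "OY a b c (2 * m) (opZ (Omod a b c (2 * m)) v) i + opZ (Omod a b c (2 * m)) (OY a b c (2 * m) v) i = OX a (2 * m) v i + (2 * b * c - a * (2 * of_nat m + 1)) * v i"
    "opZ (Omod a b c (2 * m)) (OX a (2 * m) v) i + OX a (2 * m) (opZ (Omod a b c (2 * m)) v) i = OY a b c (2 * m) v i + (2 * c * a - b * (2 * of_nat m + 1)) * v i"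
proof -
  note z = opZ_Omod[OF assms] opZ_Omod[OF O_closed(1)] opZ_Omod[OF O_closed(2)]
  have 0: "OX a (2 * m) u i = 0" "OY a b c (2 * m) u i = 0" "OZ a b c (2 * m) u i = 0" if "\<not> i \<le> 2 * m" for u
    using that by (simp_all add: OX_def OY_def OZ_def)
  show "OX a (2 * m) (OY a b c (2 * m) v) i + OY a b c (2 * m) (OX a (2 * m) v) i = opZ (Omod a b c (2 * m)) v i + (2 * a * b - c * (2 * of_nat m + 1)) * v i"
    "OY a b c (2 * m) (opZ (Omod a b c (2 * m)) v) i + opZ (Omod a b c (2 * m)) (OY a b c (2 * m) v) i = OX a (2 * m) v i + (2 * b * c - a * (2 * of_nat m + 1)) * v i"
    "opZ (Omod a b c (2 * m)) (OX a (2 * m) v) i + OX a (2 * m) (opZ (Omod a b c (2 * m)) v) i = OY a b c (2 * m) v i + (2 * c * a - b * (2 * of_nat m + 1)) * v i"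
    unfolding z
    using O_rel_XY[OF assms] O_rel_YZ[OF assms] O_rel_ZX[OF assms] 0 OspaceD[OF assms, of i]
    by (cases "i \<le> 2 * m"; simp)+
qed

lemmas lin_neg = lin_comb2[where q = 0 and p = "-1", simplified]

lemma opZ_closed: "v \<in> Ospace (2 * m) \<Longrightarrow> opZ (Omod a b c (2 * m)) v \<in> Ospace (2 * m)"
  by (simp add: opZ_Omod)

text \<open>The generators act as -Z, Y, -X, so the parameters become (-c, b, -a). Since Y is
  unchanged, the first unit vector serves as the eigenvector for theta*_0.\<close>

lemma iso_W1:
  assumes irr: "bim_irred (twist (-1, 1) perm13 (Omod a b c (2 * m)))"
    and top: "\<And>i. i \<le> 2 * m \<Longrightarrow> Otheta b (2 * m) i \<noteq> Otheta b (2 * m) (Suc (2 * m))"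
  shows "bim_iso (twist (-1, 1) perm13 (Omod a b c (2 * m))) (Omod (- c) b (- a) (2 * m))"
proof -
  let ?W = "twist (-1, 1) perm13 (Omod a b c (2 * m))" and ?O = "Omod a b c (2 * m)"
  note W = twist_W1[of a b c "2 * m"]
  let ?e = "(\<lambda>i. if i = 0 then 1 else 0) :: nat \<Rightarrow> complex"
  have e: "?e \<in> Ospace (2 * m)" by (simp add: Ospace_def)
  interpret split_module ?W "- c" b "- a" m ?e
  proof
    show "car ?W = Ospace (2 * m)" by (rule W)
    show "lin_on UNIV (opX ?W)" "lin_on UNIV (opY ?W)"
      unfolding W by (intro lin_on_scale_comp lin_on_opZ lin_on_OY)+
    fix v :: "nat \<Rightarrow> complex" and i assume v: "v \<in> Ospace (2 * m)"
    show "opX ?W v \<in> Ospace (2 * m)" using OspaceD[OF opZ_closed[OF v]] unfolding W Ospace_def by simp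
    show "opX ?W (opY ?W v) i + opY ?W (opX ?W v) i = opZ ?W v i + (2 * - c * b - - a * (2 * of_nat m + 1)) * v i"
      using Omod_relations(2)[OF v, of a b c i] unfolding W by (simp add: lin_neg[OF lin_on_OY]) algebra
    show "opZ ?W (opX ?W v) i + opX ?W (opZ ?W v) i = opY ?W v i + (2 * - a * - c - b * (2 * of_nat m + 1)) * v i"
      using Omod_relations(3)[OF v, of a b c i] unfolding W by (simp add: lin_neg[OF lin_on_OX] lin_neg[OF lin_on_opZ]) algebra
    show "v = (\<lambda>_. 0)" if "opY ?W v = (\<lambda>x. Otheta b (2 * m) (Suc (2 * m)) * v x)"
      using not_eigenvalue_OY[OF v top] that unfolding W by simp
  next
    show "?e \<in> Ospace (2 * m)" by (rule e)
    show "?e \<noteq> (\<lambda>_. 0)" by (auto simp: fun_eq_iff)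
    show "opY ?W ?e = (\<lambda>x. Otheta b (2 * m) 0 * ?e x)" unfolding W by (auto simp: OY_def fun_eq_iff)
  qed
  \<comment> \<open>The vector -Z e_0 + (c + m) e_0 is the second unit vector, which is absent from
    the carrier if m = 0.\<close>
  have v1: "vec 1 = (\<lambda>i. if i = 1 \<and> m > 0 then 1 else 0)"
    unfolding W One_nat_def split_vec.simps opZ_Omod[OF e] by (auto simp: OZ_def fun_eq_iff parity_rules)
  have "Ophi (- c) b (- a) (2 * m) (Suc 0) = Ophi a b c (2 * m) (Suc 0)" by (simp add: parity_rules)
  then have "opY ?W (vec 1) = (\<lambda>x. Otheta b (2 * m) 1 * vec 1 x + Ophi (- c) b (- a) (2 * m) 1 * ?e x)"
    unfolding v1 unfolding W by (cases m) (auto simp: OY_def fun_eq_iff parity_rules)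
  from iso[OF this irr] show ?thesis .
qed

text \<open>The generators act as -Z, -Y, X, so the parameters become (-c, -b, a). The initial
  eigenvalue of -Y is -b - m, hence v_0 must belong to the last diagonal entry theta*_d = b + m of
  Y. The three parts of \<open>ne\<close> serve the assumption \<open>top\<close>, the lemma
  \<open>opY_vec_1\<close> and the existence of v_0.\<close>

lemma iso_W2:
  assumes irr: "bim_irred (twist (1, -1) perm13 (Omod a b c (2 * m)))"
    and ne: "\<And>i. i \<le> 2 * m \<Longrightarrow> Otheta b (2 * m) i \<noteq> of_nat m + 1 - b"
      "\<And>i. i \<le> 2 * m \<Longrightarrow> Otheta b (2 * m) i \<noteq> - (1 + b + of_nat m)"
      "\<And>i. i < 2 * m \<Longrightarrow> Otheta b (2 * m) i \<noteq> b + of_nat m"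
  shows "bim_iso (twist (1, -1) perm13 (Omod a b c (2 * m))) (Omod (- c) (- b) a (2 * m))"
proof -
  let ?d = "2 * m"
  let ?W = "twist (1, -1) perm13 (Omod a b c (2 * m))" and ?O = "Omod a b c (2 * m)"
  note W = twist_W2[of a b c "2 * m"]
  \<comment> \<open>Back substitution in Y v = theta*_d v, starting with entry 1 at index d.\<close>
  define v0 where "v0 j = (if j \<le> ?d then \<Prod>l\<in>{j..<?d}. Ophi a b c ?d (Suc l) / (b + of_nat m - Otheta b ?d l) else 0)" for j
  have v0O: "v0 \<in> Ospace ?d" by (simp add: v0_def Ospace_def)
  have rec: "(b + of_nat m - Otheta b ?d j) * v0 j = Ophi a b c ?d (Suc j) * v0 (Suc j)" if "j < ?d" for j
    using that ne(3)[of j] by (simp add: v0_def prod.atLeast_Suc_lessThan)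
  have Y0: "OY a b c ?d v0 i = (b + of_nat m) * v0 i" for i
    using rec[of i] by (auto simp: OY_def v0_def Otheta_alt algebra_simps not_le)
  have v0d: "v0 ?d = 1" by (simp add: v0_def)
  interpret split_module ?W "- c" "- b" a m v0
  proof
    show "car ?W = Ospace (2 * m)" by (rule W)
    show "lin_on UNIV (opX ?W)" "lin_on UNIV (opY ?W)"
      unfolding W by (intro lin_on_scale_comp lin_on_opZ lin_on_OY)+
    fix v :: "nat \<Rightarrow> complex" and i assume v: "v \<in> Ospace (2 * m)"
    show "opX ?W v \<in> Ospace (2 * m)" using OspaceD[OF opZ_closed[OF v]] unfolding W Ospace_def by simp
    show "opX ?W (opY ?W v) i + opY ?W (opX ?W v) i = opZ ?W v i + (2 * - c * - b - a * (2 * of_nat m + 1)) * v i"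
      using Omod_relations(2)[OF v, of a b c i] unfolding W by (simp add: lin_neg[OF lin_on_OY] lin_neg[OF lin_on_opZ]) algebra
    show "opZ ?W (opX ?W v) i + opX ?W (opZ ?W v) i = opY ?W v i + (2 * a * - c - - b * (2 * of_nat m + 1)) * v i"
      using Omod_relations(3)[OF v, of a b c i] unfolding W by (simp add: lin_neg[OF lin_on_OX]) algebra
    show "v = (\<lambda>_. 0)" if "opY ?W v = (\<lambda>x. Otheta (- b) (2 * m) (Suc (2 * m)) * v x)"
    proof (rule not_eigenvalue_OY[OF v ne(1)])
      show "OY a b c (2 * m) v = (\<lambda>x. (of_nat m + 1 - b) * v x)"
        using that unfolding W by (auto simp: fun_eq_iff Otheta_alt algebra_simps minus_equation_iff)
    qed
  next
    show "v0 \<in> Ospace (2 * m)" by (rule v0O)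
    show "v0 \<noteq> (\<lambda>_. 0)" using v0d by (metis zero_neq_one)
    show "opY ?W v0 = (\<lambda>x. Otheta (- b) (2 * m) 0 * v0 x)" unfolding W using Y0 by (auto simp: fun_eq_iff Otheta_alt algebra_simps)
  qed
  have "opY ?W (vec 1) = (\<lambda>x. Otheta (- b) (2 * m) 1 * vec 1 x + Ophi (- c) (- b) a (2 * m) 1 * v0 x)"
  proof (rule opY_vec_1)
    fix v :: "nat \<Rightarrow> complex" and i assume v: "v \<in> Ospace (2 * m)"
    show "opY ?W (opZ ?W v) i + opZ ?W (opY ?W v) i = opX ?W v i + (2 * - b * a - - c * (2 * of_nat m + 1)) * v i"
      using Omod_relations(1)[OF v, of a b c i] unfolding W by (simp add: lin_neg[OF lin_on_OX] algebra_simps)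
    show "opY ?W v \<in> Ospace (2 * m)" using OspaceD[OF O_closed(2)] unfolding W Ospace_def by simp
    show "v = (\<lambda>_. 0)" if "opY ?W v = (\<lambda>x. (1 - (- b - of_nat m)) * v x)"
    proof (rule not_eigenvalue_OY[OF v ne(2)])
      show "OY a b c (2 * m) v = (\<lambda>x. - (1 + b + of_nat m) * v x)"
      proof
        fix x show "OY a b c (2 * m) v x = - (1 + b + of_nat m) * v x"
          using fun_cong[OF that, of x] unfolding W by algebra
      qed
    qed
  qed
  from iso[OF this irr] show ?thesis .
qed

text \<open>The generators act as -Z, X, -Y, so the parameters become (-c, a, -b). The role of Y
  falls to the lower bidiagonal X, whose eigenvector for theta_0 may involve all unit
  vectors.\<close>

lemma iso_W3:
  assumes irr: "bim_irred (twist (1, -1) perm132 (Omod a b c (2 * m)))"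
    and ne: "\<And>i. i \<le> 2 * m \<Longrightarrow> Otheta a (2 * m) i \<noteq> Otheta a (2 * m) (Suc (2 * m))"
  shows "bim_iso (twist (1, -1) perm132 (Omod a b c (2 * m))) (Omod (- c) a (- b) (2 * m))"
proof -
  let ?d = "2 * m"
  let ?W = "twist (1, -1) perm132 (Omod a b c (2 * m))" and ?O = "Omod a b c (2 * m)"
  note W = twist_W3[of a b c "2 * m"]
  \<comment> \<open>The equation (theta_0 - theta_i) v_i = v_{i-1} is solved downwards from v_d = 1.
    No division occurs, so a repeated diagonal entry theta_i = theta_0 does no harm.\<close>
  define v0 where "v0 j = (if j \<le> ?d then \<Prod>l\<in>{j..<?d}. Otheta a ?d 0 - Otheta a ?d (Suc l) else 0)" for j
  have v0O: "v0 \<in> Ospace ?d" by (simp add: v0_def Ospace_def)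
  have rec: "v0 j = (Otheta a ?d 0 - Otheta a ?d (Suc j)) * v0 (Suc j)" if "j < ?d" for j
    using that by (simp add: v0_def prod.atLeast_Suc_lessThan)
  have Y0: "OX a ?d v0 i = Otheta a ?d 0 * v0 i" for i
    using rec[of "i - 1"] by (cases i) (auto simp: OX_def v0_def algebra_simps)
  have v0d: "v0 ?d = 1" by (simp add: v0_def)
  interpret split_module ?W "- c" a "- b" m v0
  proof
    show "car ?W = Ospace (2 * m)" by (rule W)
    show "lin_on UNIV (opX ?W)" "lin_on UNIV (opY ?W)"
      unfolding W by (intro lin_on_scale_comp lin_on_opZ lin_on_OX)+
    fix v :: "nat \<Rightarrow> complex" and i assume v: "v \<in> Ospace (2 * m)"
    show "opX ?W v \<in> Ospace (2 * m)" using OspaceD[OF opZ_closed[OF v]] unfolding W Ospace_def by simp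
    show "opX ?W (opY ?W v) i + opY ?W (opX ?W v) i = opZ ?W v i + (2 * - c * a - - b * (2 * of_nat m + 1)) * v i"
      using Omod_relations(3)[OF v, of a b c i] unfolding W by (simp add: lin_neg[OF lin_on_OX]) algebra
    show "opZ ?W (opX ?W v) i + opX ?W (opZ ?W v) i = opY ?W v i + (2 * - b * - c - a * (2 * of_nat m + 1)) * v i"
      using Omod_relations(2)[OF v, of a b c i] unfolding W by (simp add: lin_neg[OF lin_on_OY] lin_neg[OF lin_on_opZ] algebra_simps)
    show "v = (\<lambda>_. 0)" if "opY ?W v = (\<lambda>x. Otheta a (2 * m) (Suc (2 * m)) * v x)"
      using not_eigenvalue_OX[OF v ne] that unfolding W by simp
  next
    show "v0 \<in> Ospace (2 * m)" by (rule v0O)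
    show "v0 \<noteq> (\<lambda>_. 0)" using v0d by (metis zero_neq_one)
    show "opY ?W v0 = (\<lambda>x. Otheta a (2 * m) 0 * v0 x)" unfolding W using Y0 by (auto simp: fun_eq_iff)
  qed
  \<comment> \<open>\<open>opY_vec_1\<close> does not apply: if \<open>2 * a\<close> is an odd integer, \<open>1 - Otheta a ?d 0\<close> can be an eigenvalue of \<open>Y\<close>.\<close>
  have "opY ?W (vec 1) = (\<lambda>x. Otheta a (2 * m) 1 * vec 1 x + Ophi (- c) a (- b) (2 * m) 1 * v0 x)"
  proof
    fix i
    let ?p = "Ophi a b c ?d" and ?z = "OZdiag c ?d"
    \<comment> \<open>Weighted with phi_{i+1}, the recursion for \<open>v0\<close> is also valid at
      i = d.\<close>
    have g: "?p (Suc i) * ((Otheta a ?d 0 - Otheta a ?d (Suc i)) * v0 (Suc i)) = ?p (Suc i) * v0 i" if "i \<le> ?d" for i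
      using rec[of i] that by (cases "i = ?d") auto
    define v1 where "v1 = vec 1"
    have vec: "v1 j = - OZ a b c ?d v0 j + (c + of_nat m) * v0 j" for j
      unfolding v1_def One_nat_def split_vec.simps W opZ_Omod[OF v0O] by (simp add: parity_rules) algebra
    have v1O: "v1 \<in> Ospace ?d" using v0O unfolding Ospace_def vec by (auto simp: OZ_def)
    have "OX a ?d v1 i = Otheta a (2 * m) 1 * v1 i + Ophi (- c) a (- b) (2 * m) 1 * v0 i"
    proof (cases "i \<le> ?d")
      case False
      then show ?thesis using OspaceD[OF v0O, of i] OspaceD[OF v1O, of i] by (auto simp: OX_def)
    next
      case True
      then show ?thesis
      proof (induct i rule: parity_induct)
        case zero
        show ?case using g[of 0]
          by (simp add: OX_apply v1O del: mult_cancel_left mult_cancel_right)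
            (simp add: vec OZ_apply v0O del: mult_cancel_left mult_cancel_right, simp only: parity_rules, algebra)
      next
        case one
        then show ?case
          by (simp add: OX_apply v1O del: mult_cancel_left mult_cancel_right)
            (simp add: vec OZ_apply v0O del: mult_cancel_left mult_cancel_right, simp only: parity_rules, algebra)
      next
        case (even l)
        then show ?case using g[of "Suc (Suc (2 * l))"] rec[of "2 * l"] rec[of "Suc (2 * l)"]
          by (simp add: OX_apply v1O del: mult_cancel_left mult_cancel_right)
            (simp add: vec OZ_apply v0O del: mult_cancel_left mult_cancel_right, simp only: parity_rules, algebra)
      next
        case (odd l)
        \<comment> \<open>An odd index that is at most the even number d is less than d, so the
          recursion holds at all neighbours without the weight.\<close>
        then have "Suc (Suc (Suc (2 * l))) < 2 * m" by presburger
        then have r: "v0 (Suc (2 * l)) = (Otheta a ?d 0 - Otheta a ?d (Suc (Suc (2 * l)))) * v0 (Suc (Suc (2 * l)))"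
          "v0 (Suc (Suc (2 * l))) = (Otheta a ?d 0 - Otheta a ?d (Suc (Suc (Suc (2 * l))))) * v0 (Suc (Suc (Suc (2 * l))))"
          "v0 (Suc (Suc (Suc (2 * l)))) = (Otheta a ?d 0 - Otheta a ?d (Suc (Suc (Suc (Suc (2 * l)))))) * v0 (Suc (Suc (Suc (Suc (2 * l)))))"
          by (intro rec; simp)+
        have v1: "v1 (Suc (Suc (Suc (2 * l)))) = - (?z (Suc (Suc (Suc (2 * l)))) * v0 (Suc (Suc (Suc (2 * l)))) - v0 (Suc (Suc (2 * l)))
            + ?p (Suc (Suc (Suc (Suc (2 * l))))) * v0 (Suc (Suc (Suc (Suc (2 * l)))))) + (c + of_nat m) * v0 (Suc (Suc (Suc (2 * l))))"
          "v1 (Suc (Suc (2 * l))) = - (?z (Suc (Suc (2 * l))) * v0 (Suc (Suc (2 * l))) + v0 (Suc (2 * l))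
            - ?p (Suc (Suc (Suc (2 * l)))) * v0 (Suc (Suc (Suc (2 * l))))) + (c + of_nat m) * v0 (Suc (Suc (2 * l)))"
          using odd by (simp_all add: vec OZ_apply v0O)
        have "OX a ?d v1 (Suc (Suc (Suc (2 * l)))) = Otheta a ?d (Suc (Suc (Suc (2 * l)))) * v1 (Suc (Suc (Suc (2 * l)))) + v1 (Suc (Suc (2 * l)))"
          using odd by (simp add: OX_apply v1O)
        then show ?case
          unfolding v1 unfolding r One_nat_def parity_rules by (simp only:) (simp add: algebra_simps)
      qed
    qed
    then show "opY ?W (vec 1) i = Otheta a (2 * m) 1 * vec 1 i + Ophi (- c) a (- b) (2 * m) 1 * v0 i"
      unfolding v1_def unfolding W by simp
  qed
  from iso[OF this irr] show ?thesis .
qed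

section \<open>Restriction to the plane x1 = 0\<close>

text \<open>T_i maps x_i^m to this multiple of x_i^(m-1). For m > 0 it vanishes only if m is odd and
  m = -2 k_i, which is the origin of t_i.\<close>

definition dunkl_factor :: "real \<Rightarrow> nat \<Rightarrow> complex" where
  "dunkl_factor \<kappa> m = of_nat m + of_real \<kappa> * (1 - (-1) ^ m)"

lemma dunkl_eq_factor: "dunkl k i p m = dunkl_factor (k i) (Suc (expo i m)) * p (incr i m)"
proof -
  have "expo i (incr i m) = Suc (expo i m)" by (cases m) (simp add: expo_def incr_def)
  then show ?thesis
    by (simp add: dunkl_def derivP_def divxP_def reflP_def dunkl_factor_def algebra_simps)
qed

lemma liftP_apply [simp]: "liftP P v (s, m) = P (\<lambda>m'. v (s, m')) m"
  by (simp add: liftP_def)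

lemma diracD_apply:
  "diracD k v (s, (a, b, c)) = dunkl_factor (k 1) (Suc a) * v (\<not> s, (Suc a, b, c))
     + (if s then \<i> else - \<i>) * dunkl_factor (k 2) (Suc b) * v (\<not> s, (a, Suc b, c))
     + (if s then - 1 else 1) * dunkl_factor (k 3) (Suc c) * v (s, (a, b, Suc c))"
  by (cases s) (simp_all add: diracD_def pauli_def dunkl_eq_factor expo_def incr_def)

definition sgn_of :: "bool \<Rightarrow> complex" where
  "sgn_of s = (if s then - 1 else 1)"

text \<open>Coefficient of \<open>x2^j x3^(n - j)\<close> in the component of the eigenvalue \<open>sgn_of s\<close> of \<open>e1\<close>.\<close>

definition face_coeff :: "nat \<Rightarrow> spoly \<Rightarrow> bool \<Rightarrow> nat \<Rightarrow> complex" where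
  "face_coeff n v s j = v (False, (0, j, n - j)) + sgn_of s * v (True, (0, j, n - j))"

text \<open>A relation between coefficient sequences rather than a set of operators, so that it can
  be cut down to a window or read backwards. Here \<open>s\<close> stands for the eigenvalue of e1.
  The signs belong to even n, where the exponents j and n - j have the same parity.\<close>

definition BI_action :: "real \<Rightarrow> real \<Rightarrow> real \<Rightarrow> complex \<Rightarrow> nat \<Rightarrow> (nat \<Rightarrow> complex) \<Rightarrow> (nat \<Rightarrow> complex) \<Rightarrow> (nat \<Rightarrow> complex) \<Rightarrow> (nat \<Rightarrow> complex) \<Rightarrow> bool" where
  "BI_action k1 k2 k3 s n r xr yr zr \<longleftrightarrow> (\<forall>j\<le>n.
     xr j = (1 / 2 + (-1) ^ j * (of_real k2 + of_real k3)) * r j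
       + \<i> * s * ((if j < n then dunkl_factor k2 (Suc j) * r (Suc j) else 0) - (if j = 0 then 0 else dunkl_factor k3 (Suc (n - j)) * r (j - 1)))
   \<and> yr j = (-1) ^ j * (of_nat n - of_nat j + 1 / 2 + of_real k1 + of_real k3) * r j
       - (-1) ^ j * \<i> * s * (if j < n then dunkl_factor k2 (Suc j) * r (Suc j) else 0)
   \<and> zr j = (-1) ^ j * (of_nat j + 1 / 2 + of_real k1 + of_real k2) * r j
       + (-1) ^ j * \<i> * s * (if j = 0 then 0 else dunkl_factor k3 (Suc (n - j)) * r (j - 1)))"

lemma genOp_apply:
  "genOp k i p q v (s, m) = \<i> * pauli i (liftP (\<lambda>f m. mulxP q (dunkl k p f) m - mulxP p (dunkl k q f) m) (liftP (reflP p \<circ> reflP q) v)) (s, m)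
     + 1 / 2 * ((-1) ^ expo p m * ((-1) ^ expo q m * v (s, m))) + of_real (k p) * ((-1) ^ expo q m * v (s, m))
     + of_real (k q) * ((-1) ^ expo p m * v (s, m))"
  by (simp add: genOp_def Let_def reflP_def)

lemma genOp_X_apply:
  assumes "even (j + l)"
  shows "genOp k 1 2 3 v (s, (0, j, l)) = (1 / 2 + (-1) ^ j * (of_real (k 2) + of_real (k 3))) * v (s, (0, j, l))
    + \<i> * ((if l = 0 then 0 else dunkl_factor (k 2) (Suc j) * v (\<not> s, (0, Suc j, l - 1)))
           - (if j = 0 then 0 else dunkl_factor (k 3) (Suc l) * v (\<not> s, (0, j - 1, Suc l))))"
  using assms
  by (cases "even j"; cases j; cases l; simp add: genOp_apply pauli_def mulxP_def dunkl_eq_factor reflP_def expo_def incr_def decr_def minus_one_power_iff;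
      simp add: algebra_simps)

text \<open>The Dirac equation solved for the x1-derivative. It eliminates T_1 from Y and Z on the
  plane and propagates information off the plane.\<close>

lemma Dirac_step:
  assumes "\<And>x. diracD k v x = 0"
  shows "dunkl_factor (k 1) (Suc a) * v (t, (Suc a, b, c)) = (if t then \<i> else - \<i>) * (dunkl_factor (k 2) (Suc b) * v (t, (a, Suc b, c)))
     + (if t then - 1 else 1) * (dunkl_factor (k 3) (Suc c) * v (\<not> t, (a, b, Suc c)))"
  using assms[of "(\<not> t, (a, b, c))"] by (cases t; simp add: diracD_apply; algebra)

text \<open>On x1 = 0 the term with x1 T_3 drops out, and the Dirac equation turns e2 T_1 into e1
  T_2 + i T_3. The resulting scalar term from x3 T_3 contributes (-1)^j l + k3 ((-1)^j - 1), whose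
  last part cancels the summand k3 R_1. The operator Z is treated in the same way.\<close>

lemma genOp_Y_apply:
  assumes v: "\<And>x. diracD k v x = 0" and "even (j + l)"
  shows "genOp k 2 3 1 v (s, (0, j, l)) = (-1) ^ j * (of_nat l + 1 / 2 + of_real (k 1) + of_real (k 3)) * v (s, (0, j, l))
    - (-1) ^ j * \<i> * (if l = 0 then 0 else dunkl_factor (k 2) (Suc j) * v (\<not> s, (0, Suc j, l - 1)))"
proof (cases l)
  case 0
  with assms have "even j" by simp
  then show ?thesis using 0
    by (simp add: genOp_apply pauli_def mulxP_def dunkl_eq_factor reflP_def expo_def incr_def decr_def; simp add: algebra_simps)
next
  case (Suc c)
  have b: "dunkl_factor (k 3) (Suc c) = of_nat c + 1 + of_real (k 3) * (1 - (-1) ^ Suc c)"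
    by (simp add: dunkl_factor_def)
  show ?thesis
    using assms(2) Suc
    by (cases "even j"; cases s; simp add: genOp_apply pauli_def mulxP_def dunkl_eq_factor reflP_def expo_def incr_def decr_def Dirac_step[OF v, unfolded One_nat_def] minus_one_power_iff; simp add: b minus_one_power_iff algebra_simps)
qed

lemma genOp_Z_apply:
  assumes v: "\<And>x. diracD k v x = 0" and "even (j + l)"
  shows "genOp k 3 1 2 v (s, (0, j, l)) = (-1) ^ j * (of_nat j + 1 / 2 + of_real (k 1) + of_real (k 2)) * v (s, (0, j, l))
    + (-1) ^ j * \<i> * (if j = 0 then 0 else dunkl_factor (k 3) (Suc l) * v (\<not> s, (0, j - 1, Suc l)))"
proof (cases j)
  case 0
  with assms have "even l" by simp
  then show ?thesis using 0
    by (simp add: genOp_apply pauli_def mulxP_def dunkl_eq_factor reflP_def expo_def incr_def decr_def; simp add: algebra_simps)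
next
  case (Suc b)
  have b: "dunkl_factor (k 2) (Suc b) = of_nat b + 1 + of_real (k 2) * (1 - (-1) ^ Suc b)"
    by (simp add: dunkl_factor_def)
  show ?thesis
    using assms(2) Suc
    by (cases "even j"; cases s; simp add: genOp_apply pauli_def mulxP_def dunkl_eq_factor reflP_def expo_def incr_def decr_def Dirac_step[OF v, unfolded One_nat_def] minus_one_power_iff; simp add: b minus_one_power_iff algebra_simps)
qed

lemma face_coeff_BI_action:
  assumes v: "v \<in> Mn k n" and n: "even n"
  shows "BI_action (k 1) (k 2) (k 3) (sgn_of s) n (face_coeff n v s)
    (face_coeff n (genOp k 1 2 3 v) s) (face_coeff n (genOp k 2 3 1 v) s) (face_coeff n (genOp k 3 1 2 v) s)"
  unfolding BI_action_def
proof (intro allI impI)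
  fix j assume j: "j \<le> n"
  define l where "l = n - j"
  have nj: "of_nat n = (of_nat j + of_nat l :: complex)" using j by (simp add: l_def flip: of_nat_add)
  have par: "even (j + l)" using n j by (simp add: l_def)
  have D: "diracD k v x = 0" for x using v by (simp add: Mn_def)
  have idx: "j < n \<longleftrightarrow> l \<noteq> 0" "n - j = l" "n - Suc j = l - 1" using j by (auto simp: l_def)
  have idx': "j \<noteq> 0 \<Longrightarrow> n - (j - 1) = Suc l" using j by (auto simp: l_def)
  show "face_coeff n (genOp k 1 2 3 v) s j = (1 / 2 + (-1) ^ j * (of_real (k 2) + of_real (k 3))) * face_coeff n v s j
       + \<i> * sgn_of s * ((if j < n then dunkl_factor (k 2) (Suc j) * face_coeff n v s (Suc j) else 0) - (if j = 0 then 0 else dunkl_factor (k 3) (Suc (n - j)) * face_coeff n v s (j - 1)))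
    \<and> face_coeff n (genOp k 2 3 1 v) s j = (-1) ^ j * (of_nat n - of_nat j + 1 / 2 + of_real (k 1) + of_real (k 3)) * face_coeff n v s j
       - (-1) ^ j * \<i> * sgn_of s * (if j < n then dunkl_factor (k 2) (Suc j) * face_coeff n v s (Suc j) else 0)
    \<and> face_coeff n (genOp k 3 1 2 v) s j = (-1) ^ j * (of_nat j + 1 / 2 + of_real (k 1) + of_real (k 2)) * face_coeff n v s j
       + (-1) ^ j * \<i> * sgn_of s * (if j = 0 then 0 else dunkl_factor (k 3) (Suc (n - j)) * face_coeff n v s (j - 1))"
    using idx' unfolding face_coeff_def idx genOp_X_apply[OF par] genOp_Y_apply[OF D par] genOp_Z_apply[OF D par] nj
    by (intro conjI; simp add: sgn_of_def; simp add: algebra_simps)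
qed

section \<open>Cauchy--Kovalevskaya extension off the plane x1 = 0\<close>

primrec ck_ext :: "(nat \<Rightarrow> real) \<Rightarrow> (bool \<Rightarrow> nat \<Rightarrow> nat \<Rightarrow> complex) \<Rightarrow> nat \<Rightarrow> bool \<Rightarrow> nat \<Rightarrow> nat \<Rightarrow> complex" where
  "ck_ext k r 0 s b c = r s b c"
| "ck_ext k r (Suc a) s b c = - ((if s then - \<i> else \<i>) * dunkl_factor (k 2) (Suc b) * ck_ext k r a s (Suc b) c
     + (if s then 1 else - 1) * dunkl_factor (k 3) (Suc c) * ck_ext k r a (\<not> s) b (Suc c)) / dunkl_factor (k 1) (Suc a)"

lemma ck_ext_homog: "(\<And>s b c. b + c \<noteq> n \<Longrightarrow> r s b c = 0) \<Longrightarrow> a + b + c \<noteq> n \<Longrightarrow> ck_ext k r a s b c = 0"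
  by (induction a arbitrary: s b c) simp_all

lemma dunkl_factor_nz:
  assumes "enat n < tpar k i" "a < n"
  shows "dunkl_factor (k i) (Suc a) \<noteq> 0"
proof
  assume z: "dunkl_factor (k i) (Suc a) = 0"
  show False
  proof (cases "even a")
    case True
    then have "of_real (real (Suc a) + 2 * k i) = (0 :: complex)" using z by (simp add: dunkl_factor_def mult.commute)
    then have "2 * k i = - real (Suc a)" by (simp only: of_real_eq_0_iff)
    then have "tpar k i = enat (Suc a)"
      using True unfolding tpar_def by (metis even_Suc floor_of_nat minus_mult_left minus_minus nat_int)
    then show False using assms by simp
  next
    case False
    then have "of_nat (Suc a) = (0 :: complex)" using z by (simp add: dunkl_factor_def)
    then show False by (simp only: of_nat_eq_0_iff)
  qed
qed

text \<open>In degree below n, the coefficients of D v vanish by construction, as the divisors are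
  nonzero there. In degree n or more they involve only coefficients of v in degree above n, which
  are 0.\<close>

lemma ck_ext_in_Mn:
  assumes t: "enat n < tpar k 1" and r: "\<And>s b c. b + c \<noteq> n \<Longrightarrow> r s b c = 0"
  shows "(\<lambda>(s, (a, b, c)). ck_ext k r a s b c) \<in> Mn k n"
proof -
  let ?v = "\<lambda>(s, (a, b, c)). ck_ext k r a s b c"
  have H: "ck_ext k r a s b c = 0" if "a + b + c \<noteq> n" for s a b c
    using ck_ext_homog[of n r] r that by blast
  then have "?v \<in> homog n" unfolding homog_def mdeg_def by force
  moreover have "diracD k ?v (s, (a, b, c)) = 0" for s a b c
  proof (cases "a + b + c < n")
    case False
    then show ?thesis using H by (simp add: diracD_apply del: ck_ext.simps)
  next
    case True
    then have "dunkl_factor (k 1) (Suc a) \<noteq> 0" using dunkl_factor_nz[OF t] by simp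
    then show ?thesis by (cases s) (simp_all add: diracD_apply)
  qed
  then have "diracD k ?v = (\<lambda>_. 0)" by (auto simp: fun_eq_iff)
  ultimately show ?thesis by (simp add: Mn_def)
qed

text \<open>\<open>P\<close> is a region of exponents of x2 and x3 that the recursion in x1 never
  leaves: a step to a neighbour stays in \<open>P\<close> or carries a zero factor. Vanishing on the
  plane therefore spreads to all powers of x1. With \<open>P\<close> always true this is uniqueness
  of the extension; with b < t2 or c < t3 it describes the submodules.\<close>

lemma Mn_vanish:
  assumes t: "enat n < tpar k 1" and v: "v \<in> Mn k n"
    and B: "\<And>b c. P b c \<Longrightarrow> dunkl_factor (k 2) (Suc b) = 0 \<or> P (Suc b) c" "\<And>b c. P b c \<Longrightarrow> dunkl_factor (k 3) (Suc c) = 0 \<or> P b (Suc c)"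
    and z: "\<And>s j. j \<le> n \<Longrightarrow> P j (n - j) \<Longrightarrow> face_coeff n v s j = 0"
  shows "P b c \<Longrightarrow> v (s, (a, b, c)) = 0"
proof -
  have H: "v (s, (a, b, c)) = 0" if "a + b + c \<noteq> n" for s a b c
    using v that unfolding Mn_def homog_def mdeg_def by force
  show "P b c \<Longrightarrow> v (s, (a, b, c)) = 0"
  proof (induction a arbitrary: s b c)
    case 0
    show ?case
    proof (cases "b + c = n")
      case True
      then have "face_coeff n v False b = 0" "face_coeff n v True b = 0" and c: "n - b = c" using z[of b] 0 by auto
      then have "v (False, (0, b, c)) = 0" "v (True, (0, b, c)) = 0"
        by (simp_all add: face_coeff_def sgn_of_def eq_neg_iff_add_eq_0[symmetric])
      then show ?thesis by (cases s) simp_all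
    next
      case False then show ?thesis using H by simp
    qed
  next
    case (Suc a)
    show ?case
    proof (cases "Suc a \<le> n")
      case False then show ?thesis using H by simp
    next
      case True
      have D: "diracD k v x = 0" for x using v by (simp add: Mn_def)
      have "dunkl_factor (k 2) (Suc b) * v (s', (a, Suc b, c)) = 0" "dunkl_factor (k 3) (Suc c) * v (s', (a, b, Suc c)) = 0" for s'
        using Suc B by (metis mult_eq_0_iff)+
      then have "dunkl_factor (k 1) (Suc a) * v (s, (Suc a, b, c)) = 0"
        unfolding Dirac_step[OF D] by (simp only: mult_zero_right add_0_right)
      then show ?thesis using dunkl_factor_nz[OF t, of a] True by simp
  qed
qed
qed

lemma tpar_odd:
  assumes "tpar k i = enat t"
  shows "odd t" "2 * k i = - real t" "dunkl_factor (k i) t = 0"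
proof -
  obtain j :: nat where j: "odd j" "2 * k i = - real j" using assms by (auto simp: tpar_def split: if_splits)
  then have "tpar k i = enat j" using j unfolding tpar_def by (metis floor_of_nat minus_mult_left minus_minus nat_int)
  then have "t = j" using assms by simp
  then show t: "odd t" "2 * k i = - real t" using j by simp_all
  have "dunkl_factor (k i) t = of_real (real t + 2 * k i)" using t(1) by (simp add: dunkl_factor_def mult.commute)
  then show "dunkl_factor (k i) t = 0" using t(2) by simp
qed

section \<open>Windows of the bidiagonal action\<close>

primrec cum_prod :: "(nat \<Rightarrow> complex) \<Rightarrow> nat \<Rightarrow> complex" where
  "cum_prod w 0 = 1"
| "cum_prod w (Suc i) = w i * cum_prod w i"

definition rescale :: "nat \<Rightarrow> nat \<Rightarrow> (nat \<Rightarrow> complex) \<Rightarrow> (nat \<Rightarrow> complex) \<Rightarrow> nat \<Rightarrow> complex" where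
  "rescale d j0 w r = (\<lambda>i. if i \<le> d then r (j0 + i) / cum_prod w i else 0)"

lemma cum_prod_nz: "(\<And>l. l < i \<Longrightarrow> w l \<noteq> 0) \<Longrightarrow> cum_prod w i \<noteq> 0"
  by (induction i) auto

text \<open>Rescaling a basis preserves the diagonals and the products of opposite off-diagonal
  entries, so matching with O amounts to \<open>a\<close>, \<open>b\<close>, \<open>c\<close> and
  \<open>phi\<close>. The assumptions \<open>low\<close> and \<open>high\<close> hide the neighbours
  of the window. The factor (-1)^i is absorbed by O and \<open>w\<close>; what is left is (-1)^j0 in
  front of Y and Z.\<close>

lemma BI_action_rescale:
  fixes s a b c :: complex and k1 k2 k3 :: real and n j0 m :: nat
  defines "w \<equiv> \<lambda>i. (-1) ^ Suc i * \<i> * s * dunkl_factor k3 (n - j0 - i)"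
  assumes BI: "BI_action k1 k2 k3 s n r xr yr zr"
    and s: "s * s = 1" and n: "j0 + 2 * m < n"
    and nz: "\<And>i. i < 2 * m \<Longrightarrow> dunkl_factor k3 (n - j0 - i) \<noteq> 0"
    and low: "j0 = 0 \<or> r (j0 - 1) = 0" and high: "dunkl_factor k2 (Suc (j0 + 2 * m)) = 0 \<or> r (Suc (j0 + 2 * m)) = 0"
    and a: "a - of_nat m = of_nat j0 + 1 / 2 + of_real k1 + of_real k2"
    and b: "of_nat m - b = of_nat n - of_nat j0 + 1 / 2 + of_real k1 + of_real k3"
    and c: "c + of_nat m + 1 / 2 = - ((-1) ^ j0) * (of_real k2 + of_real k3)"
    and phi: "\<And>i. i < 2 * m \<Longrightarrow> Ophi a b c (2 * m) (Suc i) = dunkl_factor k2 (Suc (j0 + i)) * dunkl_factor k3 (n - j0 - i)"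
  shows "rescale (2 * m) j0 w xr i = - OZ a b c (2 * m) (rescale (2 * m) j0 w r) i"
    "rescale (2 * m) j0 w yr i = - ((-1) ^ j0) * OY a b c (2 * m) (rescale (2 * m) j0 w r) i"
    "rescale (2 * m) j0 w zr i = (-1) ^ j0 * OX a (2 * m) (rescale (2 * m) j0 w r) i"
proof -
  let ?q = "rescale (2 * m) j0 w" and ?d = "2 * m"
  define e f :: complex where "e = (-1) ^ j0" and "f = (-1) ^ i"
  have ef: "(-1) ^ (j0 + i) = e * f" by (simp add: e_def f_def power_add)
  have ee: "e * e = 1" "f * f = 1" unfolding e_def f_def by (simp_all flip: power_mult_distrib)
  have wnz: "w l \<noteq> 0" if "l < ?d" for l using nz[OF that] s unfolding w_def by auto
  have g: "cum_prod w l \<noteq> 0" if "l \<le> ?d" for l using wnz that by (intro cum_prod_nz) auto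
  have all: "?q xr i = - OZ a b c ?d (?q r) i \<and> ?q yr i = - ((-1) ^ j0) * OY a b c ?d (?q r) i
     \<and> ?q zr i = (-1) ^ j0 * OX a ?d (?q r) i"
  proof (cases "i \<le> ?d")
    case False then show ?thesis by (simp add: rescale_def OX_def OY_def OZ_def)
  next
    case True
    define U where "U = (if i = 0 then 0 else ?q r (i - 1))"
    define V where "V = (if i < ?d then Ophi a b c ?d (Suc i) * ?q r (Suc i) else 0)"
    define R where "R = ?q r i"
    have up: "\<i> * s * (dunkl_factor k2 (Suc (j0 + i)) * r (Suc (j0 + i))) / cum_prod w i = f * V"
    proof (cases "i < ?d")
      case True
      then have "?q r (Suc i) = r (Suc (j0 + i)) / (w i * cum_prod w i)" by (simp add: rescale_def)
      then have "f * V = f * (dunkl_factor k2 (Suc (j0 + i)) * dunkl_factor k3 (n - j0 - i)) * (r (Suc (j0 + i)) / (w i * cum_prod w i))"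
        using True phi by (simp add: V_def)
      also have "\<dots> = (f * dunkl_factor k3 (n - j0 - i) / w i) * (dunkl_factor k2 (Suc (j0 + i)) * r (Suc (j0 + i)) / cum_prod w i)"
        by simp
      \<comment> \<open>Since the square of \<open>\<i> * s\<close> is -1, the sign in
        \<open>w\<close> that makes the subdiagonal 1 also fits the superdiagonal.\<close>
      also have "f * dunkl_factor k3 (n - j0 - i) / w i = \<i> * s"
      proof -
        have "\<i> * s * w i = f * dunkl_factor k3 (n - j0 - i)"
          using s unfolding w_def f_def by (simp add: algebra_simps)
        then show ?thesis using wnz[OF True] by (simp add: field_simps)
      qed
      finally show ?thesis by simp
    next
      case False
      then have "i = ?d" using \<open>i \<le> ?d\<close> by simp
      then show ?thesis using high by (auto simp: V_def)
    qed
    have down: "(if j0 + i = 0 then 0 else \<i> * s * (dunkl_factor k3 (Suc (n - (j0 + i))) * r (j0 + i - 1))) / cum_prod w i = f * U"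
    proof (cases i)
      case 0 then show ?thesis using low by (auto simp: U_def)
    next
      case (Suc l)
      have nl: "Suc (n - (j0 + i)) = n - j0 - l" using n Suc True by simp
      have "\<i> * s * (dunkl_factor k3 (n - j0 - l) * r (j0 + l)) = f * (r (j0 + l) / cum_prod w l) * (w l * cum_prod w l)"
        using g[of l] Suc True ee(2) unfolding w_def f_def by (simp add: algebra_simps)
      then show ?thesis using Suc True g[of i] unfolding nl by (simp add: U_def rescale_def field_simps)
    qed
    have dX: "Otheta a ?d i = f * (of_nat (j0 + i) + 1 / 2 + of_real k1 + of_real k2)"
      using a unfolding Otheta_alt f_def by simp
    have dY: "Otheta b ?d i = - f * (of_nat n - of_nat (j0 + i) + 1 / 2 + of_real k1 + of_real k3)"
    proof -
      have "b - of_nat m + of_nat i = - (of_nat n - of_nat (j0 + i) + 1 / 2 + of_real k1 + of_real k3)"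
        using b by (simp add: algebra_simps)
      moreover have "Otheta b ?d i = f * (b - of_nat m + of_nat i)" by (simp add: Otheta_alt f_def)
      ultimately show ?thesis by (simp only: mult_minus_left mult_minus_right)
    qed
    have dZ: "OZdiag c ?d i = - f * e * (of_real k2 + of_real k3) - 1 / 2"
    proof -
      have "OZdiag c ?d i = f * (c + of_nat m + 1 / 2) - 1 / 2" by (simp add: OZdiag_def f_def field_simps)
      then show ?thesis unfolding c e_def[symmetric] by (simp add: mult.assoc)
    qed
    have X: "OX a ?d (?q r) i = Otheta a ?d i * R + U" using True by (simp add: OX_def U_def R_def)
    have Y: "OY a b c ?d (?q r) i = Otheta b ?d i * R + V" using True by (simp add: OY_def V_def R_def)
    have Z: "OZ a b c ?d (?q r) i = OZdiag c ?d i * R + f * U - f * V" using True by (simp add: OZ_def U_def V_def R_def f_def)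
    have Rq: "r (j0 + i) / cum_prod w i = R" using True by (simp add: rescale_def R_def)
    have lt: "j0 + i < n" "j0 + i \<le> n" using n True by auto
    note bi = BI[unfolded BI_action_def, rule_format, OF lt(2), unfolded ef]
    have "xr (j0 + i) = (1 / 2 + e * f * (of_real k2 + of_real k3)) * r (j0 + i) + \<i> * s * (dunkl_factor k2 (Suc (j0 + i)) * r (Suc (j0 + i)))
       - (if j0 + i = 0 then 0 else \<i> * s * (dunkl_factor k3 (Suc (n - (j0 + i))) * r (j0 + i - 1)))"
      using bi lt(1) by (auto simp: algebra_simps)
    then have "?q xr i = (1 / 2 + e * f * (of_real k2 + of_real k3)) * R + f * V - f * U"
      using True unfolding up[symmetric] down[symmetric] Rq[symmetric] by (simp add: rescale_def diff_divide_distrib add_divide_distrib)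
    then have x: "?q xr i = - OZ a b c ?d (?q r) i" unfolding Z dZ by (simp add: algebra_simps)
    have "yr (j0 + i) = e * f * (of_nat n - of_nat (j0 + i) + 1 / 2 + of_real k1 + of_real k3) * r (j0 + i)
        - e * f * (\<i> * s * (dunkl_factor k2 (Suc (j0 + i)) * r (Suc (j0 + i))))"
      using bi lt(1) by (auto simp: algebra_simps)
    then have "?q yr i = e * f * (of_nat n - of_nat (j0 + i) + 1 / 2 + of_real k1 + of_real k3) * R - e * f * (f * V)"
      using True unfolding up[symmetric] Rq[symmetric] by (simp add: rescale_def diff_divide_distrib)
    then have y: "?q yr i = - ((-1) ^ j0) * OY a b c ?d (?q r) i"
      unfolding Y dY e_def[symmetric] using ee by algebra
    have "zr (j0 + i) = e * f * (of_nat (j0 + i) + 1 / 2 + of_real k1 + of_real k2) * r (j0 + i)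
        + e * f * (if j0 + i = 0 then 0 else \<i> * s * (dunkl_factor k3 (Suc (n - (j0 + i))) * r (j0 + i - 1)))"
      using bi by (auto simp: algebra_simps)
    then have "?q zr i = e * f * (of_nat (j0 + i) + 1 / 2 + of_real k1 + of_real k2) * R + e * f * (f * U)"
      using True unfolding down[symmetric] Rq[symmetric] by (simp add: rescale_def add_divide_distrib)
    then have z: "?q zr i = (-1) ^ j0 * OX a ?d (?q r) i"
      unfolding X dX e_def[symmetric] using ee by algebra
    show ?thesis using x y z by blast
  qed
  then show "?q xr i = - OZ a b c ?d (?q r) i" "?q yr i = - ((-1) ^ j0) * OY a b c ?d (?q r) i"
     "?q zr i = (-1) ^ j0 * OX a ?d (?q r) i" by blast+
qed

text \<open>This is the exchange of x2 and x3: the monomials are reversed, Y and Z are interchanged,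
  and the antisymmetric x3 T_2 - x2 T_3 changes sign, which \<open>s\<close> absorbs. Reversal keeps
  the parity of j because n is even.\<close>

lemma BI_action_mirror:
  assumes "BI_action k1 k2 k3 s n r xr yr zr" "even n"
  shows "BI_action k1 k3 k2 (- s) n (\<lambda>j. r (n - j)) (\<lambda>j. xr (n - j)) (\<lambda>j. zr (n - j)) (\<lambda>j. yr (n - j))"
  unfolding BI_action_def
proof (intro allI impI)
  fix j assume j: "j \<le> n"
  have par: "(-1) ^ (n - j) = ((-1) ^ j :: complex)" using assms(2) j by (simp add: minus_one_power_iff)
  note bi = assms(1)[unfolded BI_action_def, rule_format, of "n - j", unfolded par]
  have idx: "n - j < n \<longleftrightarrow> j \<noteq> 0" "n - j = 0 \<longleftrightarrow> \<not> j < n" "n - (n - j) = j" using j by auto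
  have idx': "j \<noteq> 0 \<Longrightarrow> Suc (n - j) = n - (j - 1)" using j by auto
  have cst: "of_nat (n - j) = (of_nat n - of_nat j :: complex)" using j by (simp add: of_nat_diff)
  have idx'': "n - j - 1 = n - Suc j" by simp
  show "xr (n - j) = (1 / 2 + (-1) ^ j * (of_real k3 + of_real k2)) * r (n - j)
       + \<i> * (- s) * ((if j < n then dunkl_factor k3 (Suc j) * r (n - Suc j) else 0) - (if j = 0 then 0 else dunkl_factor k2 (Suc (n - j)) * r (n - (j - 1))))
   \<and> zr (n - j) = (-1) ^ j * (of_nat n - of_nat j + 1 / 2 + of_real k1 + of_real k2) * r (n - j)
       - (-1) ^ j * \<i> * (- s) * (if j < n then dunkl_factor k3 (Suc j) * r (n - Suc j) else 0)
   \<and> yr (n - j) = (-1) ^ j * (of_nat j + 1 / 2 + of_real k1 + of_real k3) * r (n - j)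
       + (-1) ^ j * \<i> * (- s) * (if j = 0 then 0 else dunkl_factor k2 (Suc (n - j)) * r (n - (j - 1)))"
    using bi idx' unfolding idx idx'' cst by (cases "j = 0"; cases "j < n"; simp; simp add: algebra_simps)
qed

section \<open>Face coefficients as coordinates on the submodules and quotients\<close>

lemma face_coeff_linear:
  "face_coeff n (\<lambda>x. u x + v x) s j = face_coeff n u s j + face_coeff n v s j" "face_coeff n (\<lambda>x. c * u x) s j = c * face_coeff n u s j"
  by (simp_all add: face_coeff_def algebra_simps)

lemma Mn_exists:
  assumes t: "enat n < tpar k 1"
  obtains v where "v \<in> Mn k n" "\<And>s j. j \<le> n \<Longrightarrow> face_coeff n v s j = r s j"
proof -
  \<comment> \<open>Inverse of the passage from the two components to the eigencoordinates of
    e1.\<close>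
  define R where "R s b c = (if b + c = n then (r False b + sgn_of s * r True b) / 2 else 0)" for s b c
  let ?v = "\<lambda>(s, (a, b, c)). ck_ext k R a s b c"
  have "?v \<in> Mn k n" by (rule ck_ext_in_Mn[OF t]) (simp add: R_def)
  moreover have "face_coeff n ?v s j = r s j" if "j \<le> n" for s j
    using that by (cases s) (simp_all add: face_coeff_def R_def sgn_of_def field_simps)
  ultimately show thesis using that by blast
qed

lemma Mn_eq_zero:
  assumes "enat n < tpar k 1" "v \<in> Mn k n" "\<And>s j. j \<le> n \<Longrightarrow> face_coeff n v s j = 0"
  shows "v = (\<lambda>_. 0)"
proof
  fix x :: "bool \<times> mono" obtain s a b c where "x = (s, (a, b, c))" by (cases x)
  then show "v x = 0" using Mn_vanish[of n k v "\<lambda>_ _. True"] assms by simp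
qed

text \<open>Divisibility by x2^t2 need only be tested on the plane: the region b < t2 is closed
  under the recursion because T_2 annihilates x2^t2.\<close>

lemma Mnx_2_iff:
  assumes t: "enat n < tpar k 1" and t2: "tpar k 2 = enat t2"
  shows "v \<in> Mnx k n 2 \<longleftrightarrow> v \<in> Mn k n \<and> (\<forall>s j. j \<le> n \<longrightarrow> j < t2 \<longrightarrow> face_coeff n v s j = 0)"
proof (intro iffI conjI)
  assume v: "v \<in> Mnx k n 2"
  then show "v \<in> Mn k n" by (simp add: Mnx_def)
  have "v (s, (a, b, c)) = 0" if "b < t2" for s a b c
    using v that t2 by (force simp: Mnx_def expo_def)
  then show "\<forall>s j. j \<le> n \<longrightarrow> j < t2 \<longrightarrow> face_coeff n v s j = 0" by (simp add: face_coeff_def)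
next
  assume v: "v \<in> Mn k n \<and> (\<forall>s j. j \<le> n \<longrightarrow> j < t2 \<longrightarrow> face_coeff n v s j = 0)"
  have "v (s, (a, b, c)) = 0" if "b < t2" for s a b c
    using v that tpar_odd(3)[OF t2]
    by (intro Mn_vanish[OF t, of v "\<lambda>b c. b < t2"]) (auto, metis Suc_lessI)
  then show "v \<in> Mnx k n 2" using v t2 by (force simp: Mnx_def expo_def not_less)
qed

lemma Mnx_3_iff:
  assumes t: "enat n < tpar k 1" and t3: "tpar k 3 = enat t3"
  shows "v \<in> Mnx k n 3 \<longleftrightarrow> v \<in> Mn k n \<and> (\<forall>s j. j \<le> n \<longrightarrow> n - j < t3 \<longrightarrow> face_coeff n v s j = 0)"
proof (intro iffI conjI)
  assume v: "v \<in> Mnx k n 3"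
  then show "v \<in> Mn k n" by (simp add: Mnx_def)
  have "v (s, (a, b, c)) = 0" if "c < t3" for s a b c
    using v that t3 by (force simp: Mnx_def expo_def)
  then show "\<forall>s j. j \<le> n \<longrightarrow> n - j < t3 \<longrightarrow> face_coeff n v s j = 0" by (simp add: face_coeff_def)
next
  assume v: "v \<in> Mn k n \<and> (\<forall>s j. j \<le> n \<longrightarrow> n - j < t3 \<longrightarrow> face_coeff n v s j = 0)"
  have "v (s, (a, b, c)) = 0" if "c < t3" for s a b c
    using v that tpar_odd(3)[OF t3]
    by (intro Mn_vanish[OF t, of v "\<lambda>b c. c < t3"]) (auto, metis Suc_lessI)
  then show "v \<in> Mnx k n 3" using v t3 by (force simp: Mnx_def expo_def not_less)
qed

text \<open>The map \<open>\<pi>\<close> will be the identity or the reversal of 0, ..., n, and the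
  two summands of the target correspond to the eigenvalues of e1.\<close>

definition face_coord :: "nat \<Rightarrow> nat \<Rightarrow> nat \<Rightarrow> (nat \<Rightarrow> nat) \<Rightarrow> (bool \<Rightarrow> nat \<Rightarrow> complex) \<Rightarrow> spoly \<Rightarrow> bool \<times> nat \<Rightarrow> complex" where
  "face_coord n d j0 \<pi> w v = (\<lambda>(s, i). rescale d j0 (w s) (\<lambda>j. face_coeff n v s (\<pi> j)) i)"

lemma face_coord_hom:
  assumes W: "car W = Ospace d"
    and ops: "\<And>v s. v \<in> S \<Longrightarrow> rescale d j0 (w s) (\<lambda>j. face_coeff n (genOp k 1 2 3 v) s (\<pi> j)) = opX W (rescale d j0 (w s) (\<lambda>j. face_coeff n v s (\<pi> j)))"
     "\<And>v s. v \<in> S \<Longrightarrow> rescale d j0 (w s) (\<lambda>j. face_coeff n (genOp k 2 3 1 v) s (\<pi> j)) = opY W (rescale d j0 (w s) (\<lambda>j. face_coeff n v s (\<pi> j)))"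
     "\<And>v s. v \<in> S \<Longrightarrow> rescale d j0 (w s) (\<lambda>j. face_coeff n (genOp k 3 1 2 v) s (\<pi> j)) = opZ W (rescale d j0 (w s) (\<lambda>j. face_coeff n v s (\<pi> j)))"
  shows "bim_hom (Mmod k S) (dsum2 W) (face_coord n d j0 \<pi> w)"
  using ops by (auto simp: bim_hom_def Mmod_def dsum2_def W Ospace_def face_coord_def rescale_def lin_on_def face_coeff_linear
      fun_eq_iff add_divide_distrib)

lemma face_coord_onto:
  assumes t: "enat n < tpar k 1" and d: "j0 + d \<le> n"
    and \<pi>: "\<And>j. j \<le> n \<Longrightarrow> \<pi> j \<le> n \<and> \<pi> (\<pi> j) = j"
    and w: "\<And>s i. i < d \<Longrightarrow> w s i \<noteq> 0"
    and y: "\<And>s i. d < i \<Longrightarrow> y (s, i) = 0"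
  obtains v where "v \<in> Mn k n" "face_coord n d j0 \<pi> w v = y"
    "\<And>s j. j \<le> n \<Longrightarrow> \<pi> j < j0 \<or> j0 + d < \<pi> j \<Longrightarrow> face_coeff n v s j = 0"
proof -
  \<comment> \<open>Undoes the rescaling inside the window. The zeros outside place the preimage in
    the submodules defined by vanishing there.\<close>
  define r where "r s j = (if j0 \<le> \<pi> j \<and> \<pi> j \<le> j0 + d then cum_prod (w s) (\<pi> j - j0) * y (s, \<pi> j - j0) else 0)" for s j
  obtain v where v: "v \<in> Mn k n" "\<And>s j. j \<le> n \<Longrightarrow> face_coeff n v s j = r s j"
    using Mn_exists[OF t, of r] by blast
  have "face_coord n d j0 \<pi> w v (s, i) = y (s, i)" for s i
  proof (cases "i \<le> d")
    case False then show ?thesis using y by (simp add: face_coord_def rescale_def)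
  next
    case True
    then have "cum_prod (w s) i \<noteq> 0" using w by (intro cum_prod_nz) auto
    then show ?thesis using True d \<pi>[of "j0 + i"] by (simp add: face_coord_def rescale_def v(2) r_def)
  qed
  then have "face_coord n d j0 \<pi> w v = y" by (auto simp: fun_eq_iff)
  then show thesis using v by (intro that[of v]) (auto simp: r_def)
qed

lemma face_coord_zero:
  assumes "face_coord n d j0 \<pi> w v = (\<lambda>_. 0)" "\<And>s i. i < d \<Longrightarrow> w s i \<noteq> 0" "i \<le> d"
  shows "face_coeff n v s (\<pi> (j0 + i)) = 0"
proof -
  have "cum_prod (w s) i \<noteq> 0" using assms(2,3) by (intro cum_prod_nz) auto
  then show ?thesis using fun_cong[OF assms(1), of "(s, i)"] assms(3) by (simp add: face_coord_def rescale_def)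
qed

text \<open>The domain \<open>S\<close> may be anything between the elements supported on the window
  and all of \<open>Mn k n\<close>, so that the two quotients in (ii), and the two in (iii), come
  from one argument.\<close>

lemma face_coord_quot_iso:
  assumes t: "enat n < tpar k 1" and d: "d \<le> n" and W: "car W = Ospace d"
    and \<pi>: "\<And>j. j \<le> n \<Longrightarrow> \<pi> j \<le> n \<and> \<pi> (\<pi> j) = j"
    and w: "\<And>s i. i < d \<Longrightarrow> w s i \<noteq> 0"
    and hom: "bim_hom (Mmod k S) (dsum2 W) (face_coord n d 0 \<pi> w)"
    and S: "\<And>v. v \<in> Mn k n \<Longrightarrow> (\<And>s j. j \<le> n \<Longrightarrow> d < \<pi> j \<Longrightarrow> face_coeff n v s j = 0) \<Longrightarrow> v \<in> S" "S \<subseteq> Mn k n"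
    and T: "\<And>v. v \<in> S \<Longrightarrow> v \<in> T \<longleftrightarrow> (\<forall>s j. j \<le> n \<longrightarrow> \<pi> j \<le> d \<longrightarrow> face_coeff n v s j = 0)" "T \<subseteq> S"
  shows "bim_quot_iso (Mmod k S) T (dsum2 W)"
  unfolding bim_quot_iso_def
proof (intro exI conjI)
  let ?f = "face_coord n d 0 \<pi> w"
  have carM: "car (Mmod k S) = S" by (simp add: Mmod_def)
  have carD: "car (dsum2 W) = {y. \<forall>s i. d < i \<longrightarrow> y (s, i) = 0}" by (simp add: dsum2_def W Ospace_def)
  show "bim_hom (Mmod k S) (dsum2 W) ?f" by (rule hom)
  show "?f ` car (Mmod k S) = car (dsum2 W)"
  proof
    show "?f ` car (Mmod k S) \<subseteq> car (dsum2 W)" using hom by (auto simp: bim_hom_def)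
    show "car (dsum2 W) \<subseteq> ?f ` car (Mmod k S)"
    proof
      fix y assume "y \<in> car (dsum2 W)"
      then have y: "d < i \<Longrightarrow> y (s, i) = 0" for s i by (auto simp: carD)
      obtain v where "v \<in> Mn k n" "?f v = y" "\<And>s j. j \<le> n \<Longrightarrow> \<pi> j < 0 \<or> 0 + d < \<pi> j \<Longrightarrow> face_coeff n v s j = 0"
        using face_coord_onto[of n k 0 d \<pi> w y] t d \<pi> w y by auto
      then show "y \<in> ?f ` car (Mmod k S)" using S(1) carM by auto
    qed
  qed
  show "{v \<in> car (Mmod k S). ?f v = (\<lambda>_. 0)} = T"
  proof (intro equalityI subsetI)
    fix v assume "v \<in> {v \<in> car (Mmod k S). ?f v = (\<lambda>_. 0)}"
    then have v: "v \<in> S" "?f v = (\<lambda>_. 0)" by (auto simp: carM)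
    have "face_coeff n v s j = 0" if "j \<le> n" "\<pi> j \<le> d" for s j
      using face_coord_zero[OF v(2) w that(2), of s] \<pi>[OF that(1)] by simp
    then show "v \<in> T" using T(1)[OF v(1)] by blast
  next
    fix v assume v: "v \<in> T"
    then have "v \<in> S" using T(2) by blast
    then have z: "face_coeff n v s j = 0" if "j \<le> n" "\<pi> j \<le> d" for s j using T(1) v that by blast
    have "?f v (s, i) = 0" for s i
      using z[of "\<pi> i" s] \<pi>[of i] d by (auto simp: face_coord_def rescale_def)
    then have "?f v = (\<lambda>_. 0)" by (auto simp: fun_eq_iff)
    then show "v \<in> {v \<in> car (Mmod k S). ?f v = (\<lambda>_. 0)}" using \<open>v \<in> S\<close> carM by auto
  qed
qed

lemma face_coord_iso:
  assumes t: "enat n < tpar k 1" and d: "j0 + d \<le> n" and W: "car W = Ospace d"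
    and w: "\<And>s i. i < d \<Longrightarrow> w s i \<noteq> 0"
    and hom: "bim_hom (Mmod k S) (dsum2 W) (face_coord n d j0 (\<lambda>j. j) w)"
    and S: "\<And>v. v \<in> S \<longleftrightarrow> v \<in> Mn k n \<and> (\<forall>s j. j \<le> n \<longrightarrow> j < j0 \<or> j0 + d < j \<longrightarrow> face_coeff n v s j = 0)"
  shows "bim_iso (Mmod k S) (dsum2 W)"
  unfolding bim_iso_def
proof (intro exI conjI)
  let ?f = "face_coord n d j0 (\<lambda>j. j) w"
  have carM: "car (Mmod k S) = S" by (simp add: Mmod_def)
  have carD: "car (dsum2 W) = {y. \<forall>s i. d < i \<longrightarrow> y (s, i) = 0}" by (simp add: dsum2_def W Ospace_def)
  show "bim_hom (Mmod k S) (dsum2 W) ?f" by (rule hom)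
  show "bij_betw ?f (car (Mmod k S)) (car (dsum2 W))"
    unfolding bij_betw_def
  proof
    show "inj_on ?f (car (Mmod k S))" unfolding carM
    proof (rule inj_onI)
      fix u v assume uv: "u \<in> S" "v \<in> S" "?f u = ?f v"
      let ?x = "\<lambda>x. u x + (-1) * v x"
      have "diracD k ?x (s, (a, b, c)) = 0" for s a b c
      proof -
        have "diracD k u (s, (a, b, c)) = 0" "diracD k v (s, (a, b, c)) = 0" using uv S by (auto simp: Mn_def)
        then show ?thesis by (cases s; simp add: diracD_apply; algebra)
      qed
      moreover have "?x \<in> homog n"
        unfolding homog_def mem_Collect_eq
      proof (intro allI impI)
        fix s m assume x: "u (s, m) + - 1 * v (s, m) \<noteq> 0"
        have "u \<in> homog n" "v \<in> homog n" using uv(1,2) S by (simp_all add: Mn_def)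
        then have "u (s, m) \<noteq> 0 \<Longrightarrow> mdeg m = n" "v (s, m) \<noteq> 0 \<Longrightarrow> mdeg m = n"
          unfolding homog_def by blast+
        then show "mdeg m = n" using x by fastforce
      qed
      ultimately have M: "?x \<in> Mn k n" by (auto simp: Mn_def fun_eq_iff)
      have f0: "?f ?x = (\<lambda>_. 0)"
      proof
        fix y :: "bool \<times> nat" obtain s i where y: "y = (s, i)" by (cases y)
        have "?f u (s, i) = ?f v (s, i)" using uv by simp
        then show "?f ?x y = 0" unfolding y by (simp only: face_coord_def rescale_def face_coeff_linear split: if_splits) (auto simp: diff_divide_distrib)
      qed
      have "face_coeff n ?x s j = 0" if "j \<le> n" for s j
      proof (cases "j < j0 \<or> j0 + d < j")
        case True
        then have "face_coeff n u s j = 0" "face_coeff n v s j = 0" using uv S that by blast+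
        then show ?thesis unfolding face_coeff_linear by simp
      next
        case False
        then have "j - j0 \<le> d" "j0 + (j - j0) = j" by auto
        then show ?thesis using face_coord_zero[OF f0 w, of "j - j0" s] by simp
      qed
      then have "?x = (\<lambda>_. 0)" by (rule Mn_eq_zero[OF t M])
      then show "u = v" by (auto simp: fun_eq_iff)
    qed
    show "?f ` car (Mmod k S) = car (dsum2 W)"
    proof
      show "?f ` car (Mmod k S) \<subseteq> car (dsum2 W)" using hom by (auto simp: bim_hom_def)
      show "car (dsum2 W) \<subseteq> ?f ` car (Mmod k S)"
      proof
        fix y assume "y \<in> car (dsum2 W)"
        then have y: "d < i \<Longrightarrow> y (s, i) = 0" for s i by (auto simp: carD)
        obtain v where "v \<in> Mn k n" "?f v = y" "\<And>s j. j \<le> n \<Longrightarrow> j < j0 \<or> j0 + d < j \<Longrightarrow> face_coeff n v s j = 0"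
          using face_coord_onto[of n k j0 d "\<lambda>j. j" w y] t d w y by auto
        then show "y \<in> ?f ` car (Mmod k S)" using S carM by auto
      qed
    qed
  qed
qed

section \<open>Parameters of the windows\<close>

lemma dunkl_factor_odd_param:
  assumes "2 * \<kappa> = - real t" "odd t"
  shows "even j \<Longrightarrow> dunkl_factor \<kappa> j = of_nat j" "odd j \<Longrightarrow> dunkl_factor \<kappa> j = of_nat j - of_nat t"
proof -
  have "of_real (2 * \<kappa>) = (- of_nat t :: complex)" unfolding assms by simp
  then show "even j \<Longrightarrow> dunkl_factor \<kappa> j = of_nat j" "odd j \<Longrightarrow> dunkl_factor \<kappa> j = of_nat j - of_nat t"
    by (simp_all add: dunkl_factor_def mult.commute)
qed

lemma dunkl_factor_odd_param_nz:
  assumes "2 * \<kappa> = - real t" "odd t" "t < j"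
  shows "dunkl_factor \<kappa> j \<noteq> 0"
  using dunkl_factor_odd_param[OF assms(1,2), of j] assms(3) by (cases "even j") auto

text \<open>The scale factors \<open>w\<close> normalize the subdiagonal of the lower bidiagonal operator to 1.\<close>

lemma quotient_seq:
  fixes k1 k2 k3 :: real and t2 t3 n m :: nat and s :: complex
  defines "w \<equiv> \<lambda>i. (-1) ^ Suc i * \<i> * s * dunkl_factor k3 (n - i)"
    and "A \<equiv> complex_of_real k1" and "B \<equiv> - complex_of_real (k1 + k2 + k3) - of_nat n - 1" and "C \<equiv> - complex_of_real k3"
  assumes BI: "BI_action k1 k2 k3 s n r xr yr zr" and s: "s * s = 1" and "even n"
    and k2: "2 * k2 = - real t2" "odd t2" and k3: "2 * k3 = - real t3" "odd t3"
    and le: "t2 + t3 \<le> n" and m: "t2 = Suc (2 * m)"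
  shows "rescale (2 * m) 0 w xr = (\<lambda>i. - OZ A B C (2 * m) (rescale (2 * m) 0 w r) i)"
    "rescale (2 * m) 0 w yr = (\<lambda>i. - OY A B C (2 * m) (rescale (2 * m) 0 w r) i)"
    "rescale (2 * m) 0 w zr = OX A (2 * m) (rescale (2 * m) 0 w r)"
    "\<And>i. i < 2 * m \<Longrightarrow> w i \<noteq> 0"
proof -
  have k2': "complex_of_real k2 = - of_nat m - 1 / 2"
  proof -
    have "k2 = - real m - 1 / 2" using k2 m by simp
    then show ?thesis by simp
  qed
  \<comment> \<open>For i < t2 - 1 one has n - i > t3, beyond the only positive zero of the
    factor.\<close>
  have nz: "dunkl_factor k3 (n - 0 - i) \<noteq> 0" if "i < 2 * m" for i
    using that le m by (intro dunkl_factor_odd_param_nz[OF k3]) simp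
  then show wnz: "w i \<noteq> 0" if "i < 2 * m" for i using that s by (auto simp: w_def)
  have phi: "Ophi A B C (2 * m) (Suc i) = dunkl_factor k2 (Suc (0 + i)) * dunkl_factor k3 (n - 0 - i)" if "i < 2 * m" for i
  proof -
    have n: "of_nat (n - i) = (of_nat n - of_nat i :: complex)" using that le m by (simp add: of_nat_diff)
    have par: "even (n - i) \<longleftrightarrow> even i" using \<open>even n\<close> that le m by simp
    have b3: "dunkl_factor k3 (n - i) = of_nat n - of_nat i + of_real k3 * (1 - (-1) ^ i)"
      using par by (simp add: dunkl_factor_def n minus_one_power_iff)
    have b2: "dunkl_factor k2 (Suc i) = of_nat i + 1 - (of_nat m + 1 / 2) * (1 + (-1) ^ i)"
      unfolding dunkl_factor_def k2' by (simp add: algebra_simps)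
    show ?thesis
      by (cases "even i"; simp add: b2 b3 Ophi_def A_def B_def C_def k2'; simp add: field_simps)
  qed
  have low: "0 = (0::nat) \<or> r (0 - 1) = 0" by simp
  \<comment> \<open>The factor vanishes at t2, so the coefficients to the right of the window do not
    enter, whatever they are. This makes the window a quotient.\<close>
  have high: "dunkl_factor k2 (Suc (0 + 2 * m)) = 0 \<or> r (Suc (0 + 2 * m)) = 0"
    using dunkl_factor_odd_param(2)[OF k2, of t2] m k2 by simp
  have lt: "0 + 2 * m < n" using le m by simp
  have a: "A - of_nat m = of_nat 0 + 1 / 2 + of_real k1 + of_real k2" by (simp add: A_def k2')
  have b: "of_nat m - B = of_nat n - of_nat 0 + 1 / 2 + of_real k1 + of_real k3" by (simp add: B_def k2')
  have c: "C + of_nat m + 1 / 2 = - ((-1) ^ 0) * (of_real k2 + of_real k3)" by (simp add: C_def k2')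
  have wd: "(\<lambda>i. (-1) ^ Suc i * \<i> * s * dunkl_factor k3 (n - 0 - i)) = w" by (simp add: w_def)
  note S = BI_action_rescale[OF BI s lt nz low high a b c phi, unfolded wd]
  show "rescale (2 * m) 0 w xr = (\<lambda>i. - OZ A B C (2 * m) (rescale (2 * m) 0 w r) i)"
    "rescale (2 * m) 0 w yr = (\<lambda>i. - OY A B C (2 * m) (rescale (2 * m) 0 w r) i)"
    "rescale (2 * m) 0 w zr = OX A (2 * m) (rescale (2 * m) 0 w r)"
    using S by (auto simp: fun_eq_iff)
qed

text \<open>The window runs from t2 to n - t3, and both neighbouring coefficients vanish for an
  element of the intersection. As it starts at an odd exponent, Y and Z have the opposite sign to
  the window at 0, whence the different sign twist of W1.\<close>

lemma intersection_seq:
  fixes k1 k2 k3 :: real and t2 t3 n m :: nat and s :: complex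
  defines "w \<equiv> \<lambda>i. (-1) ^ Suc i * \<i> * s * dunkl_factor k3 (n - t2 - i)"
    and "A \<equiv> complex_of_real k1 + of_real k3 + (of_nat n + 1) / 2" and "B \<equiv> - complex_of_real k1 - of_real k2 - (of_nat n + 1) / 2"
    and "C \<equiv> - ((of_nat n + 1) / 2 :: complex)"
  assumes BI: "BI_action k1 k2 k3 s n r xr yr zr" and s: "s * s = 1" and "even n"
    and k2: "2 * k2 = - real t2" "odd t2" and k3: "2 * k3 = - real t3" "odd t3"
    and m: "n = t2 + t3 + 2 * m"
    and low: "r (t2 - 1) = 0" and high: "r (Suc (t2 + 2 * m)) = 0"
  shows "rescale (2 * m) t2 w xr = (\<lambda>i. - OZ A B C (2 * m) (rescale (2 * m) t2 w r) i)"
    "rescale (2 * m) t2 w yr = OY A B C (2 * m) (rescale (2 * m) t2 w r)"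
    "rescale (2 * m) t2 w zr = (\<lambda>i. - OX A (2 * m) (rescale (2 * m) t2 w r) i)"
    "\<And>i. i < 2 * m \<Longrightarrow> w i \<noteq> 0"
proof -
  have k2': "complex_of_real k2 = - of_nat t2 / 2" and k3': "complex_of_real k3 = - of_nat t3 / 2"
  proof -
    have "k2 = - real t2 / 2" "k3 = - real t3 / 2" using k2 k3 by simp_all
    then show "complex_of_real k2 = - of_nat t2 / 2" "complex_of_real k3 = - of_nat t3 / 2" by simp_all
  qed
  have n': "of_nat n = (of_nat t2 + of_nat t3 + 2 * of_nat m :: complex)" unfolding m by simp
  have nz: "dunkl_factor k3 (n - t2 - i) \<noteq> 0" if "i < 2 * m" for i
    using that m by (intro dunkl_factor_odd_param_nz[OF k3]) simp
  then show wnz: "w i \<noteq> 0" if "i < 2 * m" for i using that s by (auto simp: w_def)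
  have phi: "Ophi A B C (2 * m) (Suc i) = dunkl_factor k2 (Suc (t2 + i)) * dunkl_factor k3 (n - t2 - i)" if "i < 2 * m" for i
  proof -
    have ni: "n - t2 - i = t3 + (2 * m - i)" using that m by simp
    have nc: "of_nat (2 * m - i) = (2 * of_nat m - of_nat i :: complex)" using that by (simp add: of_nat_diff)
    have par: "even (2 * m - i) \<longleftrightarrow> even i" using that by simp
    show ?thesis
    proof (cases "even i")
      case True
      then have "dunkl_factor k2 (Suc (t2 + i)) = of_nat t2 + of_nat i + 1" "dunkl_factor k3 (n - t2 - i) = 2 * of_nat m - of_nat i"
        using dunkl_factor_odd_param(1)[OF k2, of "Suc (t2 + i)"] dunkl_factor_odd_param(2)[OF k3, of "n - t2 - i"] k2 k3 par
        unfolding ni by (simp_all add: nc)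
      then show ?thesis using True by (simp add: Ophi_def A_def B_def C_def k2' k3' n'; simp add: field_simps)
    next
      case False
      then have "dunkl_factor k2 (Suc (t2 + i)) = of_nat i + 1" "dunkl_factor k3 (n - t2 - i) = of_nat t3 + 2 * of_nat m - of_nat i"
        using dunkl_factor_odd_param(2)[OF k2, of "Suc (t2 + i)"] dunkl_factor_odd_param(1)[OF k3, of "n - t2 - i"] k2 k3 par
        unfolding ni by (simp_all add: nc)
      then show ?thesis using False by (simp add: Ophi_def A_def B_def C_def k2' k3' n'; simp add: field_simps)
    qed
  qed
  have low': "t2 = 0 \<or> r (t2 - 1) = 0" using low by simp
  have high': "dunkl_factor k2 (Suc (t2 + 2 * m)) = 0 \<or> r (Suc (t2 + 2 * m)) = 0" using high by simp
  have lt: "t2 + 2 * m < n" using m k3(2) by (cases t3) auto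
  have sg: "(-1) ^ t2 = (-1 :: complex)" using k2 by simp
  have a: "A - of_nat m = of_nat t2 + 1 / 2 + of_real k1 + of_real k2"
    by (simp add: A_def k2' k3' n' field_simps)
  have b: "of_nat m - B = of_nat n - of_nat t2 + 1 / 2 + of_real k1 + of_real k3"
    by (simp add: B_def k2' k3' n' field_simps)
  have c: "C + of_nat m + 1 / 2 = - ((-1) ^ t2) * (of_real k2 + of_real k3)"
    unfolding sg by (simp add: C_def k2' k3' n' field_simps)
  note S = BI_action_rescale[OF BI s lt nz low' high' a b c phi, folded w_def, unfolded sg]
  show "rescale (2 * m) t2 w xr = (\<lambda>i. - OZ A B C (2 * m) (rescale (2 * m) t2 w r) i)"
    "rescale (2 * m) t2 w yr = OY A B C (2 * m) (rescale (2 * m) t2 w r)"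
    "rescale (2 * m) t2 w zr = (\<lambda>i. - OX A (2 * m) (rescale (2 * m) t2 w r) i)"
    using S by (auto simp: fun_eq_iff)
qed

section \<open>Irreducibility and isomorphisms for nonnegative k1\<close>

lemma bim_irredI_real:
  fixes A B C :: real
  assumes car: "car M = Ospace (2 * m)"
    and F: "F \<in> {opX M, opY M, opZ M}" "\<And>u. OX (of_real A) (2 * m) u = (\<lambda>x. s * F u x)"
    and G: "G \<in> {opX M, opY M, opZ M}" "\<And>u. OY (of_real A) (of_real B) (of_real C) (2 * m) u = (\<lambda>x. t * G u x)"
    and ev: "\<And>i. 1 \<le> i \<Longrightarrow> i \<le> 2 * m \<Longrightarrow> even i \<Longrightarrow> 2 * real m + 1 - 2 * real i - 2 * A - 2 * B - 2 * C \<noteq> 0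
       \<and> 2 * B - 2 * real m - 1 + real i \<noteq> 0 \<and> 2 * A + 2 * C - 2 * B + 2 * real m + 1 - 2 * real i \<noteq> 0"
    and od: "\<And>i. 1 \<le> i \<Longrightarrow> i \<le> 2 * m \<Longrightarrow> odd i \<Longrightarrow> 2 * real m + 1 - 2 * real i - 2 * A - 2 * B + 2 * C \<noteq> 0
       \<and> 2 * B + real i \<noteq> 0 \<and> 2 * A - 2 * C - 2 * B + 2 * real m + 1 - 2 * real i \<noteq> 0"
  shows "bim_irred M"
proof (rule bim_irredI[OF car F G])
  fix i assume i: "1 \<le> i" "i \<le> 2 * m"
  show "Ophi (of_real A) (of_real B) (of_real C) (2 * m) i \<noteq> 0"
  proof (cases "even i")
    case True
    then have "Ophi (of_real A) (of_real B) (of_real C) (2 * m) i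
       = of_real (real i * (2 * real m + 1 - 2 * real i - 2 * A - 2 * B - 2 * C) / 2)"
      by (simp add: Ophi_def)
    then show ?thesis using ev[OF i True] i by (simp only: of_real_eq_0_iff) simp
  next
    case False
    then have "Ophi (of_real A) (of_real B) (of_real C) (2 * m) i
       = of_real ((real i - 2 * real m - 1) * (2 * real m + 1 - 2 * real i - 2 * A - 2 * B + 2 * C) / 2)"
      by (simp add: Ophi_def)
    moreover have "real i - 2 * real m - 1 \<noteq> 0" using i(2) by linarith
    ultimately show ?thesis using od[OF i False] by (simp only: of_real_eq_0_iff) simp
  qed
next
  fix i assume i: "1 \<le> i" "i \<le> 2 * m" "even i"
  have "(2 * complex_of_real B - of_nat (2 * m) - 1 + of_nat i) * (2 * of_real A + 2 * of_real C - 2 * of_real B + of_nat (2 * m) + 1 - 2 * of_nat i)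
     = of_real ((2 * B - 2 * real m - 1 + real i) * (2 * A + 2 * C - 2 * B + 2 * real m + 1 - 2 * real i))" by simp
  then show "(2 * complex_of_real B - of_nat (2 * m) - 1 + of_nat i) * (2 * of_real A + 2 * of_real C - 2 * of_real B + of_nat (2 * m) + 1 - 2 * of_nat i) \<noteq> 0"
    using ev[OF i] by (simp only: of_real_eq_0_iff mult_eq_0_iff) simp
next
  fix i assume i: "1 \<le> i" "i \<le> 2 * m" "odd i"
  have "(2 * complex_of_real B + of_nat i) * (2 * of_real A - 2 * of_real C - 2 * of_real B + of_nat (2 * m) + 1 - 2 * of_nat i)
     = of_real ((2 * B + real i) * (2 * A - 2 * C - 2 * B + 2 * real m + 1 - 2 * real i))" by simp
  then show "(2 * complex_of_real B + of_nat i) * (2 * of_real A - 2 * of_real C - 2 * of_real B + of_nat (2 * m) + 1 - 2 * of_nat i) \<noteq> 0"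
    using od[OF i] by (simp only: of_real_eq_0_iff mult_eq_0_iff) simp
qed simp

lemma Otheta_of_real: "Otheta (of_real B) (2 * m) i = of_real (if even i then B - real m + real i else - (B - real m + real i))"
  by (simp add: Otheta_alt)

text \<open>Both permutations are treated together because W3 is the case \<open>perm132\<close>
  with k2 and k3 exchanged. For k1 >= 0, each linear factor in the irreducibility criterion has a
  constant sign over the whole range of i.\<close>

lemma W2_irred_iso:
  fixes k1 k2 k3 :: real and n m :: nat
  defines "W \<equiv> \<lambda>e. twist (1, -1) e (Omod (of_real k1) (- of_real (k1 + k2 + k3) - of_nat n - 1) (- of_real k3) (2 * m))"
  assumes k1: "k1 \<ge> 0" and k2: "2 * k2 = - real t2" and k3: "2 * k3 = - real t3"
    and t2: "t2 = Suc (2 * m)" and le: "t2 + t3 \<le> n"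
  shows "bim_irred (W perm13)" "bim_irred (W perm132)"
    "bim_iso (W perm13) (Omod (of_real k3) (of_real (k1 + k2 + k3) + of_nat n + 1) (of_real k1) (2 * m))"
    "bim_iso (W perm132) (Omod (of_real k3) (of_real k1) (of_real (k1 + k2 + k3) + of_nat n + 1) (2 * m))"
proof -
  define B where "B = - (k1 + k2 + k3) - real n - 1"
  have Bc: "- complex_of_real (k1 + k2 + k3) - of_nat n - 1 = of_real B" by (simp add: B_def)
  have Cc: "- complex_of_real k3 = of_real (- k3)" by simp
  have r: "real t2 = 2 * real m + 1" "real t2 + real t3 \<le> real n" using t2 le by linarith+
  have k2': "k2 = - real m - 1 / 2" using k2 r by simp
  have ev: "2 * real m + 1 - 2 * real i - 2 * k1 - 2 * B - 2 * (- k3) \<noteq> 0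
       \<and> 2 * B - 2 * real m - 1 + real i \<noteq> 0 \<and> 2 * k1 + 2 * (- k3) - 2 * B + 2 * real m + 1 - 2 * real i \<noteq> 0"
    and od: "2 * real m + 1 - 2 * real i - 2 * k1 - 2 * B + 2 * (- k3) \<noteq> 0
       \<and> 2 * B + real i \<noteq> 0 \<and> 2 * k1 - 2 * (- k3) - 2 * B + 2 * real m + 1 - 2 * real i \<noteq> 0" if "1 \<le> i" "i \<le> 2 * m" for i
  proof -
    have i: "real i \<le> 2 * real m" "real t3 \<ge> 0" "real m \<ge> 0" using that by linarith+
    have "2 * real m + 1 - 2 * real i - 2 * k1 - 2 * B - 2 * (- k3) > 0"
      "2 * B - 2 * real m - 1 + real i < 0" "2 * k1 + 2 * (- k3) - 2 * B + 2 * real m + 1 - 2 * real i > 0"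
      "2 * real m + 1 - 2 * real i - 2 * k1 - 2 * B + 2 * (- k3) > 0"
      "2 * B + real i < 0" "2 * k1 - 2 * (- k3) - 2 * B + 2 * real m + 1 - 2 * real i > 0"
      using k1 k3 r k2' B_def i by linarith+
    then show "2 * real m + 1 - 2 * real i - 2 * k1 - 2 * B - 2 * (- k3) \<noteq> 0
       \<and> 2 * B - 2 * real m - 1 + real i \<noteq> 0 \<and> 2 * k1 + 2 * (- k3) - 2 * B + 2 * real m + 1 - 2 * real i \<noteq> 0"
     "2 * real m + 1 - 2 * real i - 2 * k1 - 2 * B + 2 * (- k3) \<noteq> 0
       \<and> 2 * B + real i \<noteq> 0 \<and> 2 * k1 - 2 * (- k3) - 2 * B + 2 * real m + 1 - 2 * real i \<noteq> 0"
      by simp_all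
  qed
  let ?T = "twist (1, -1) perm13 (Omod (of_real k1) (of_real B) (of_real (- k3)) (2 * m))"
  let ?T' = "twist (1, -1) perm132 (Omod (of_real k1) (of_real B) (of_real (- k3)) (2 * m))"
  note W2 = twist_W2[of "of_real k1" "of_real B" "of_real (- k3)" "2 * m"]
  note W3 = twist_W3[of "of_real k1" "of_real B" "of_real (- k3)" "2 * m"]
  show irr: "bim_irred (W perm13)" unfolding W_def Bc Cc
  proof (rule bim_irredI_real[OF W2(1), of "opZ ?T" k1 1 "opY ?T" B "- k3" "- 1"])
    fix u
    show "OX (of_real k1) (2 * m) u = (\<lambda>x. 1 * opZ ?T u x)" unfolding W2 by simp
    show "OY (of_real k1) (of_real B) (of_real (- k3)) (2 * m) u = (\<lambda>x. - 1 * opY ?T u x)" unfolding W2 by simp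
  qed (use ev od in auto)
  show irr': "bim_irred (W perm132)" unfolding W_def Bc Cc
  proof (rule bim_irredI_real[OF W3(1), of "opY ?T'" k1 1 "opZ ?T'" B "- k3" "- 1"])
    fix u
    show "OX (of_real k1) (2 * m) u = (\<lambda>x. 1 * opY ?T' u x)" unfolding W3 by simp
    show "OY (of_real k1) (of_real B) (of_real (- k3)) (2 * m) u = (\<lambda>x. - 1 * opZ ?T' u x)" unfolding W3 by simp
  qed (use ev od in auto)
  have "bim_iso (W perm13) (Omod (- of_real (- k3)) (- of_real B) (of_real k1) (2 * m))"
    unfolding W_def Bc Cc
  proof (rule iso_W2)
    show "bim_irred (twist (1, - 1) perm13 (Omod (of_real k1) (of_real B) (of_real (- k3)) (2 * m)))"
      using irr unfolding W_def Bc Cc .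
    \<comment> \<open>Thus theta*_i is negative for even i and positive for odd i, and each
      forbidden value could only occur at an index outside the range in question.\<close>
    have neg: "B + real m + 1 \<le> 0" using k1 k3 r unfolding B_def k2' by linarith
    fix i
    have a: "of_nat m + 1 - of_real B = complex_of_real (real m + 1 - B)" "- (1 + of_real B + of_nat m) = complex_of_real (- (1 + B + real m))"
      "of_real B + of_nat m = complex_of_real (B + real m)" by simp_all
    { assume i: "i \<le> 2 * m"
      show "Otheta (of_real B) (2 * m) i \<noteq> of_nat m + 1 - of_real B"
        using i neg unfolding a Otheta_of_real of_real_eq_iff by auto
      show "Otheta (of_real B) (2 * m) i \<noteq> - (1 + of_real B + of_nat m)"
        using i neg unfolding a Otheta_of_real of_real_eq_iff by auto }
    assume i: "i < 2 * m"
    show "Otheta (of_real B) (2 * m) i \<noteq> of_real B + of_nat m"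
      using i neg unfolding a Otheta_of_real of_real_eq_iff by auto
  qed
  then show "bim_iso (W perm13) (Omod (of_real k3) (of_real (k1 + k2 + k3) + of_nat n + 1) (of_real k1) (2 * m))"
    by (simp add: B_def algebra_simps)
  have "bim_iso (W perm132) (Omod (- of_real (- k3)) (of_real k1) (- of_real B) (2 * m))"
    unfolding W_def Bc Cc
  proof (rule iso_W3)
    show "bim_irred (twist (1, - 1) perm132 (Omod (of_real k1) (of_real B) (of_real (- k3)) (2 * m)))"
      using irr' unfolding W_def Bc Cc .
    show "Otheta (of_real k1) (2 * m) i \<noteq> Otheta (of_real k1) (2 * m) (Suc (2 * m))" if "i \<le> 2 * m" for i
      using that k1 unfolding Otheta_of_real of_real_eq_iff by auto
  qed
  then show "bim_iso (W perm132) (Omod (of_real k3) (of_real k1) (of_real (k1 + k2 + k3) + of_nat n + 1) (2 * m))"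
    by (simp add: B_def algebra_simps)
qed

lemma W1_irred_iso:
  fixes k1 k2 k3 :: real and N :: complex and n m :: nat
  defines "N \<equiv> (of_nat n + 1) / 2"
  defines "W \<equiv> twist (-1, 1) perm13 (Omod (of_real k1 + of_real k3 + N) (- of_real k1 - of_real k2 - N) (- N) (2 * m))"
  assumes k1: "k1 \<ge> 0" and k2: "2 * k2 = - real t2" "odd t2" and k3: "2 * k3 = - real t3" "odd t3"
    and n: "n = t2 + t3 + 2 * m"
  shows "bim_irred W" "bim_iso W (Omod N (- of_real k1 - of_real k2 - N) (- of_real k1 - of_real k3 - N) (2 * m))"
proof -
  define A B C where "A = k1 + k3 + (real n + 1) / 2" and "B = - k1 - k2 - (real n + 1) / 2" and "C = - ((real n + 1) / 2)"
  have c: "of_real k1 + of_real k3 + N = of_real A" "- of_real k1 - of_real k2 - N = of_real B" "- N = of_real C"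
    by (simp_all add: A_def B_def C_def N_def)
  have r: "real n = real t2 + real t3 + 2 * real m" using n by simp
  have t: "real t2 \<ge> 1" "real t3 \<ge> 1" using k2(2) k3(2) by (metis One_nat_def Suc_leI odd_pos of_nat_1 of_nat_mono)+
  have k2': "k2 = - real t2 / 2" and k3': "k3 = - real t3 / 2" using k2 k3 by simp_all
  have ABC: "2 * A = 2 * k1 - real t3 + real n + 1" "2 * B = - 2 * k1 + real t2 - real n - 1" "2 * C = - real n - 1"
    by (simp_all add: A_def B_def C_def k2' k3' field_simps)
  have ev: "2 * real m + 1 - 2 * real i - 2 * A - 2 * B - 2 * C \<noteq> 0
       \<and> 2 * B - 2 * real m - 1 + real i \<noteq> 0 \<and> 2 * A + 2 * C - 2 * B + 2 * real m + 1 - 2 * real i \<noteq> 0"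
    and od: "2 * real m + 1 - 2 * real i - 2 * A - 2 * B + 2 * C \<noteq> 0
       \<and> 2 * B + real i \<noteq> 0 \<and> 2 * A - 2 * C - 2 * B + 2 * real m + 1 - 2 * real i \<noteq> 0" if "1 \<le> i" "i \<le> 2 * m" for i
  proof -
    have i: "real i \<le> 2 * real m" "real m \<ge> 0" "real i \<ge> 1" using that by linarith+
    have "2 * real m + 1 - 2 * real i - 2 * A - 2 * B - 2 * C > 0"
      "2 * B - 2 * real m - 1 + real i < 0" "2 * A + 2 * C - 2 * B + 2 * real m + 1 - 2 * real i > 0"
      "2 * real m + 1 - 2 * real i - 2 * A - 2 * B + 2 * C < 0"
      "2 * B + real i < 0" "2 * A - 2 * C - 2 * B + 2 * real m + 1 - 2 * real i > 0"
      using k1 t ABC r i by linarith+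
    then show "2 * real m + 1 - 2 * real i - 2 * A - 2 * B - 2 * C \<noteq> 0
       \<and> 2 * B - 2 * real m - 1 + real i \<noteq> 0 \<and> 2 * A + 2 * C - 2 * B + 2 * real m + 1 - 2 * real i \<noteq> 0"
     "2 * real m + 1 - 2 * real i - 2 * A - 2 * B + 2 * C \<noteq> 0
       \<and> 2 * B + real i \<noteq> 0 \<and> 2 * A - 2 * C - 2 * B + 2 * real m + 1 - 2 * real i \<noteq> 0"
      by simp_all
  qed
  let ?T = "twist (-1, 1) perm13 (Omod (of_real A) (of_real B) (of_real C) (2 * m))"
  note W1 = twist_W1[of "of_real A" "of_real B" "of_real C" "2 * m"]
  show irr: "bim_irred W" unfolding W_def c
  proof (rule bim_irredI_real[OF W1(1), of "opZ ?T" A "- 1" "opY ?T" B C 1])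
    fix u
    show "OX (of_real A) (2 * m) u = (\<lambda>x. - 1 * opZ ?T u x)" unfolding W1 by simp
    show "OY (of_real A) (of_real B) (of_real C) (2 * m) u = (\<lambda>x. 1 * opY ?T u x)" unfolding W1 by simp
  qed (use ev od in auto)
  have "bim_iso W (Omod (- of_real C) (of_real B) (- of_real A) (2 * m))"
    unfolding W_def c
  proof (rule iso_W1)
    show "bim_irred (twist (- 1, 1) perm13 (Omod (of_real A) (of_real B) (of_real C) (2 * m)))"
      using irr unfolding W_def c .
    \<comment> \<open>The left-hand side is -k1 - (t3 - 1) / 2, so this is where t3 >= 1
      enters.\<close>
    have neg: "B + real m + 1 \<le> 0" using k1 t unfolding B_def k2' r by (simp add: field_simps)
    show "Otheta (of_real B) (2 * m) i \<noteq> Otheta (of_real B) (2 * m) (Suc (2 * m))" if "i \<le> 2 * m" for i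
      using that neg unfolding Otheta_of_real of_real_eq_iff by auto
  qed
  moreover have "- complex_of_real C = N" "- complex_of_real A = - of_real k1 - of_real k3 - N"
    by (simp_all add: A_def C_def N_def)
  ultimately show "bim_iso W (Omod N (- of_real k1 - of_real k2 - N) (- of_real k1 - of_real k3 - N) (2 * m))"
    unfolding c(2) by simp
qed

theorem theorem8p14:
  fixes k :: "nat \<Rightarrow> real" and n t2 t3 :: nat
    and K :: real and N :: complex and W1 W2 W3 :: "nat bimod"
  assumes "even n"
    and "tpar k 2 = enat t2" and "tpar k 3 = enat t3"
    and "t2 + t3 \<le> n" and "enat n < tpar k 1"
    and "K = k 1 + k 2 + k 3" and "N = (of_nat n + 1) / 2"
    and "W1 = twist (-1, 1) perm13
           (Omod (of_real (k 1) + of_real (k 3) + N) (- of_real (k 1) - of_real (k 2) - N) (- N)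
                 (n - t2 - t3))"
    and "W2 = twist (1, -1) perm13
           (Omod (of_real (k 1)) (- of_real K - of_nat n - 1) (- of_real (k 3)) (t2 - 1))"
    and "W3 = twist (1, -1) perm132
           (Omod (of_real (k 1)) (- of_real K - of_nat n - 1) (- of_real (k 2)) (t3 - 1))"
  shows "bim_iso (Mmod k (Mnx k n 2 \<inter> Mnx k n 3)) (dsum2 W1)
       \<and> bim_quot_iso (Mmod k (Mnx k n 3)) (Mnx k n 2 \<inter> Mnx k n 3) (dsum2 W2)
       \<and> bim_quot_iso (Mmod k (Mn k n)) (Mnx k n 2) (dsum2 W2)
       \<and> bim_quot_iso (Mmod k (Mnx k n 2)) (Mnx k n 2 \<inter> Mnx k n 3) (dsum2 W3)
       \<and> bim_quot_iso (Mmod k (Mn k n)) (Mnx k n 3) (dsum2 W3)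
       \<and> (k 1 \<ge> 0 \<longrightarrow>
            bim_irred W1 \<and> bim_irred W2 \<and> bim_irred W3
          \<and> bim_iso W1 (Omod N (- of_real (k 1) - of_real (k 2) - N)
                              (- of_real (k 1) - of_real (k 3) - N) (n - t2 - t3))
          \<and> bim_iso W2 (Omod (of_real (k 3)) (of_real K + of_nat n + 1) (of_real (k 1)) (t2 - 1))
          \<and> bim_iso W3 (Omod (of_real (k 2)) (of_real (k 1)) (of_real K + of_nat n + 1) (t3 - 1)))"
proof -
  let ?k1 = "of_real (k 1) :: complex" and ?k2 = "of_real (k 2) :: complex" and ?k3 = "of_real (k 3) :: complex"
  note n = \<open>even n\<close> and t = \<open>enat n < tpar k 1\<close> and K = \<open>K = k 1 + k 2 + k 3\<close> and N = \<open>N = (of_nat n + 1) / 2\<close>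
    and le = \<open>t2 + t3 \<le> n\<close>
  note W1 = assms(8) and W2 = assms(9) and W3 = assms(10)
  note k2 = tpar_odd[OF assms(2)] and k3 = tpar_odd[OF assms(3)]
  obtain m2 m3 where m2: "t2 = Suc (2 * m2)" and m3: "t3 = Suc (2 * m3)" using k2(1) k3(1) by (auto elim!: oddE)
  have "even (n - t2 - t3)" using n k2(1) k3(1) le by simp
  then obtain m1 where m1: "n - t2 - t3 = 2 * m1" by blast
  have nm: "n = t2 + t3 + 2 * m1" using m1 le by simp
  have d2: "t2 - 1 = 2 * m2" and d3: "t3 - 1 = 2 * m3" using m2 m3 by simp_all
  have Kc: "- of_real K - of_nat n - 1 = - complex_of_real (k 1 + k 2 + k 3) - of_nat n - 1"
    and Kc': "- of_real K - of_nat n - 1 = - complex_of_real (k 1 + k 3 + k 2) - of_nat n - 1"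
    using K by simp_all
  have sq: "sgn_of s * sgn_of s = 1" "- sgn_of s * - sgn_of s = 1" for s by (simp_all add: sgn_of_def)
  note x2 = Mnx_2_iff[OF t assms(2)] and x3 = Mnx_3_iff[OF t assms(3)]
  have oz: "opZ (Omod a b c (2 * m)) (rescale (2 * m) j w r) = OZ a b c (2 * m) (rescale (2 * m) j w r)" for a b c m j w r
    by (intro opZ_Omod) (simp add: Ospace_def rescale_def)

  define w1 where "w1 s = (\<lambda>i. (-1) ^ Suc i * \<i> * sgn_of s * dunkl_factor (k 3) (n - t2 - i))" for s
  note T1 = twist_W1[of "?k1 + ?k3 + N" "- ?k1 - ?k2 - N" "- N" "2 * m1", folded m1, folded W1, unfolded m1]
  have seq1: "rescale (2 * m1) t2 (w1 s) (\<lambda>j. face_coeff n (genOp k 1 2 3 v) s j) = opX W1 (rescale (2 * m1) t2 (w1 s) (\<lambda>j. face_coeff n v s j))"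
    "rescale (2 * m1) t2 (w1 s) (\<lambda>j. face_coeff n (genOp k 2 3 1 v) s j) = opY W1 (rescale (2 * m1) t2 (w1 s) (\<lambda>j. face_coeff n v s j))"
    "rescale (2 * m1) t2 (w1 s) (\<lambda>j. face_coeff n (genOp k 3 1 2 v) s j) = opZ W1 (rescale (2 * m1) t2 (w1 s) (\<lambda>j. face_coeff n v s j))"
    if v: "v \<in> Mnx k n 2 \<inter> Mnx k n 3" for v s
  proof -
    have vM: "v \<in> Mn k n" and v2: "\<And>j. j \<le> n \<Longrightarrow> j < t2 \<Longrightarrow> face_coeff n v s j = 0" and v3: "\<And>j. j \<le> n \<Longrightarrow> n - j < t3 \<Longrightarrow> face_coeff n v s j = 0"
      using v unfolding Int_iff x2 x3 by blast+
    have "face_coeff n v s (t2 - 1) = 0" "face_coeff n v s (Suc (t2 + 2 * m1)) = 0"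
      using v2[of "t2 - 1"] v3[of "Suc (t2 + 2 * m1)"] nm m2 m3 by simp_all
    note q = intersection_seq[OF face_coeff_BI_action[OF vM n, of s] sq(1) n k2(2,1) k3(2,1) nm this, folded w1_def N]
    show "rescale (2 * m1) t2 (w1 s) (\<lambda>j. face_coeff n (genOp k 1 2 3 v) s j) = opX W1 (rescale (2 * m1) t2 (w1 s) (\<lambda>j. face_coeff n v s j))"
    "rescale (2 * m1) t2 (w1 s) (\<lambda>j. face_coeff n (genOp k 2 3 1 v) s j) = opY W1 (rescale (2 * m1) t2 (w1 s) (\<lambda>j. face_coeff n v s j))"
    "rescale (2 * m1) t2 (w1 s) (\<lambda>j. face_coeff n (genOp k 3 1 2 v) s j) = opZ W1 (rescale (2 * m1) t2 (w1 s) (\<lambda>j. face_coeff n v s j))"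
      using q(1-3) unfolding T1 oz by (simp_all add: N)
  qed
  have w1: "w1 s i \<noteq> 0" if "i < 2 * m1" for s i
    using that dunkl_factor_odd_param_nz[OF k3(2,1), of "n - t2 - i"] nm by (auto simp: w1_def sgn_of_def)
  have iso1: "bim_iso (Mmod k (Mnx k n 2 \<inter> Mnx k n 3)) (dsum2 W1)"
  proof (rule face_coord_iso[OF t _ T1(1) w1 face_coord_hom[OF T1(1) seq1]])
    show "t2 + 2 * m1 \<le> n" using nm by simp
    show "v \<in> Mnx k n 2 \<inter> Mnx k n 3 \<longleftrightarrow> v \<in> Mn k n \<and> (\<forall>s j. j \<le> n \<longrightarrow> j < t2 \<or> t2 + 2 * m1 < j \<longrightarrow> face_coeff n v s j = 0)" for v
    proof -
      have "n - j < t3 \<longleftrightarrow> t2 + 2 * m1 < j" if "j \<le> n" for j using that nm by linarith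
      then show ?thesis unfolding Int_iff x2 x3 by blast
    qed
  qed

  define w2 where "w2 s = (\<lambda>i. (-1) ^ Suc i * \<i> * sgn_of s * dunkl_factor (k 3) (n - i))" for s
  note T2 = twist_W2[of ?k1 "- of_real K - of_nat n - 1" "- ?k3" "2 * m2", folded d2, folded W2, unfolded d2]
  have seq2: "rescale (2 * m2) 0 (w2 s) (\<lambda>j. face_coeff n (genOp k 1 2 3 v) s j) = opX W2 (rescale (2 * m2) 0 (w2 s) (\<lambda>j. face_coeff n v s j))"
    "rescale (2 * m2) 0 (w2 s) (\<lambda>j. face_coeff n (genOp k 2 3 1 v) s j) = opY W2 (rescale (2 * m2) 0 (w2 s) (\<lambda>j. face_coeff n v s j))"
    "rescale (2 * m2) 0 (w2 s) (\<lambda>j. face_coeff n (genOp k 3 1 2 v) s j) = opZ W2 (rescale (2 * m2) 0 (w2 s) (\<lambda>j. face_coeff n v s j))"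
    if v: "v \<in> Mn k n" for v s
  proof -
    note q = quotient_seq[OF face_coeff_BI_action[OF v n, of s] sq(1) n k2(2,1) k3(2,1) le m2, folded w2_def Kc]
    show "rescale (2 * m2) 0 (w2 s) (\<lambda>j. face_coeff n (genOp k 1 2 3 v) s j) = opX W2 (rescale (2 * m2) 0 (w2 s) (\<lambda>j. face_coeff n v s j))"
    "rescale (2 * m2) 0 (w2 s) (\<lambda>j. face_coeff n (genOp k 2 3 1 v) s j) = opY W2 (rescale (2 * m2) 0 (w2 s) (\<lambda>j. face_coeff n v s j))"
    "rescale (2 * m2) 0 (w2 s) (\<lambda>j. face_coeff n (genOp k 3 1 2 v) s j) = opZ W2 (rescale (2 * m2) 0 (w2 s) (\<lambda>j. face_coeff n v s j))"
      using q(1-3) unfolding T2 oz by simp_all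
  qed
  have w2: "w2 s i \<noteq> 0" if "i < 2 * m2" for s i
    using that dunkl_factor_odd_param_nz[OF k3(2,1), of "n - i"] le m2 by (auto simp: w2_def sgn_of_def)
  have quo2: "bim_quot_iso (Mmod k S) T (dsum2 W2)"
    if S: "S \<subseteq> Mn k n" "\<And>v. v \<in> Mn k n \<Longrightarrow> (\<And>s j. j \<le> n \<Longrightarrow> 2 * m2 < j \<Longrightarrow> face_coeff n v s j = 0) \<Longrightarrow> v \<in> S"
      and T: "T = S \<inter> Mnx k n 2" for S T
  proof (rule face_coord_quot_iso[OF t _ T2(1) _ w2 _ S(2,1)])
    show "bim_hom (Mmod k S) (dsum2 W2) (face_coord n (2 * m2) 0 (\<lambda>j. j) w2)"
      by (rule face_coord_hom[OF T2(1)]; rule seq2; use S(1) in blast)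
    show "2 * m2 \<le> n" using le m2 by simp
    show "T \<subseteq> S" using T by auto
    show "v \<in> T \<longleftrightarrow> (\<forall>s j. j \<le> n \<longrightarrow> j \<le> 2 * m2 \<longrightarrow> face_coeff n v s j = 0)" if "v \<in> S" for v
      using that S(1) m2 unfolding T by (auto simp: x2)
  qed (use S in auto)

  \<comment> \<open>The minus sign before \<open>sgn_of s\<close> is the one introduced by
    \<open>BI_action_mirror\<close>.\<close>
  define w3 where "w3 s = (\<lambda>i. (-1) ^ Suc i * \<i> * (- sgn_of s) * dunkl_factor (k 2) (n - i))" for s
  note T3 = twist_W3[of ?k1 "- of_real K - of_nat n - 1" "- ?k2" "2 * m3", folded d3, folded W3, unfolded d3]
  have seq3: "rescale (2 * m3) 0 (w3 s) (\<lambda>j. face_coeff n (genOp k 1 2 3 v) s (n - j)) = opX W3 (rescale (2 * m3) 0 (w3 s) (\<lambda>j. face_coeff n v s (n - j)))"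
    "rescale (2 * m3) 0 (w3 s) (\<lambda>j. face_coeff n (genOp k 2 3 1 v) s (n - j)) = opY W3 (rescale (2 * m3) 0 (w3 s) (\<lambda>j. face_coeff n v s (n - j)))"
    "rescale (2 * m3) 0 (w3 s) (\<lambda>j. face_coeff n (genOp k 3 1 2 v) s (n - j)) = opZ W3 (rescale (2 * m3) 0 (w3 s) (\<lambda>j. face_coeff n v s (n - j)))"
    if v: "v \<in> Mn k n" for v s
  proof -
    have le': "t3 + t2 \<le> n" using le by simp
    note q = quotient_seq[OF BI_action_mirror[OF face_coeff_BI_action[OF v n, of s] n] sq(2) n k3(2,1) k2(2,1) le' m3, folded w3_def Kc']
    show "rescale (2 * m3) 0 (w3 s) (\<lambda>j. face_coeff n (genOp k 1 2 3 v) s (n - j)) = opX W3 (rescale (2 * m3) 0 (w3 s) (\<lambda>j. face_coeff n v s (n - j)))"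
    "rescale (2 * m3) 0 (w3 s) (\<lambda>j. face_coeff n (genOp k 2 3 1 v) s (n - j)) = opY W3 (rescale (2 * m3) 0 (w3 s) (\<lambda>j. face_coeff n v s (n - j)))"
    "rescale (2 * m3) 0 (w3 s) (\<lambda>j. face_coeff n (genOp k 3 1 2 v) s (n - j)) = opZ W3 (rescale (2 * m3) 0 (w3 s) (\<lambda>j. face_coeff n v s (n - j)))"
      using q(1-3) unfolding T3 oz by simp_all
  qed
  have w3: "w3 s i \<noteq> 0" if "i < 2 * m3" for s i
    using that dunkl_factor_odd_param_nz[OF k2(2,1), of "n - i"] le m3 by (auto simp: w3_def sgn_of_def)
  have quo3: "bim_quot_iso (Mmod k S) T (dsum2 W3)"
    if S: "S \<subseteq> Mn k n" "\<And>v. v \<in> Mn k n \<Longrightarrow> (\<And>s j. j \<le> n \<Longrightarrow> 2 * m3 < n - j \<Longrightarrow> face_coeff n v s j = 0) \<Longrightarrow> v \<in> S"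
      and T: "T = S \<inter> Mnx k n 3" for S T
  proof (rule face_coord_quot_iso[OF t _ T3(1) _ w3 _ S(2,1)])
    show "bim_hom (Mmod k S) (dsum2 W3) (face_coord n (2 * m3) 0 (\<lambda>j. n - j) w3)"
      by (rule face_coord_hom[OF T3(1)]; rule seq3; use S(1) in blast)
    show "2 * m3 \<le> n" using le m3 by simp
    show "T \<subseteq> S" using T by auto
    show "v \<in> T \<longleftrightarrow> (\<forall>s j. j \<le> n \<longrightarrow> n - j \<le> 2 * m3 \<longrightarrow> face_coeff n v s j = 0)" if "v \<in> S" for v
      using that S(1) m3 unfolding T by (auto simp: x3)
  qed (use S in auto)

  \<comment> \<open>If only coefficients with j < t2 are nonzero, those with n - j < t3 vanish
    because t2 + t3 <= n. So every element supported on the window already lies in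
    \<open>Mnx k n 3\<close>, and restricting to this submodule loses nothing in the
    quotient.\<close>
  have "bim_quot_iso (Mmod k (Mnx k n 3)) (Mnx k n 2 \<inter> Mnx k n 3) (dsum2 W2)"
    using le m2 by (intro quo2) (auto simp: x2 x3)
  moreover have "bim_quot_iso (Mmod k (Mn k n)) (Mnx k n 2) (dsum2 W2)"
    by (intro quo2) (auto simp: x2 x3)
  moreover have "bim_quot_iso (Mmod k (Mnx k n 2)) (Mnx k n 2 \<inter> Mnx k n 3) (dsum2 W3)"
    using le m3 by (intro quo3) (auto simp: x2 x3)
  moreover have "bim_quot_iso (Mmod k (Mn k n)) (Mnx k n 3) (dsum2 W3)"
    by (intro quo3) (auto simp: x2 x3)
  moreover have "bim_irred W1 \<and> bim_irred W2 \<and> bim_irred W3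
          \<and> bim_iso W1 (Omod N (- of_real (k 1) - of_real (k 2) - N) (- of_real (k 1) - of_real (k 3) - N) (n - t2 - t3))
          \<and> bim_iso W2 (Omod (of_real (k 3)) (of_real K + of_nat n + 1) (of_real (k 1)) (t2 - 1))
          \<and> bim_iso W3 (Omod (of_real (k 2)) (of_real (k 1)) (of_real K + of_nat n + 1) (t3 - 1))"
    if k1: "k 1 \<ge> 0"
  proof -
    have le': "t3 + t2 \<le> n" using le by simp
    have K': "K = k 1 + k 3 + k 2" using K by simp
    note A = W1_irred_iso[OF k1 k2(2,1) k3(2,1) nm, folded N, folded m1, folded W1]
    note B = W2_irred_iso[OF k1 k2(2) k3(2) m2 le, folded K, folded d2, folded W2]
    \<comment> \<open>The same lemma with the indices 2 and 3 exchanged; its statements on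
      \<open>perm132\<close> concern W3.\<close>
    note C = W2_irred_iso[OF k1 k3(2) k2(2) m3 le', folded K', folded d3, folded W3]
    show ?thesis using A B(1,3) C(2,4) by blast
  qed
  ultimately show ?thesis using iso1 by blast
qed

end
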